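(* For every nonnegative integer $p$, $$\sum_{m=0}^{p} Z_-(2m)\,Z^\star_+(2p-2m)=(2p+2)\bigl(2p+1+2^{-(2p+2)}\bigr)\zeta(2p+4).$$
   Context: For positive integers $\alpha_1,\ldots,\alpha_r$ with $\alpha_r\ge 2$, $\zeta(\alpha_1,\ldots,\alpha_r)=\sum_{1\le k_1<\cdots<k_r}k_1^{-\alpha_1}\cdots k_r^{-\alpha_r}$ and $\zeta^\star(\alpha_1,\ldots,\alpha_r)=\sum_{1\le k_1\le\cdots\le k_r}k_1^{-\alpha_1}\cdots k_r^{-\alpha_r}$; $\zeta(s)$ is the Riemann zeta function. $\{1\}^a$ denotes $a$ repetitions of $1$. For a nonnegative integer $n$, $Z_-(n)=\sum_{a+b=n}(-1)^b\zeta(\{1\}^a,b+2)$ and $Z^\star_+(n)=\sum_{a+b=n}\zeta^\star(\{1\}^a,b+2)$, sums over nonnegative integers $a,b$. *)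

theory Defs
  imports "HOL-Analysis.Analysis"
begin

text \<open>
  The index \<open>[\<alpha>\<^sub>1, \<dots>, \<alpha>\<^sub>r]\<close> is a list of positive integers; a summation point
  \<open>k\<^sub>1 < \<dots> < k\<^sub>r\<close> (respectively \<open>k\<^sub>1 \<le> \<dots> \<le> k\<^sub>r\<close>) is a list \<open>ks\<close> of the same
  length. The series have nonnegative terms and converge when \<open>\<alpha>\<^sub>r \<ge> 2\<close>, so the unordered
  sum \<^const>\<open>infsum\<close> is their usual value.
\<close>

definition mzv_term :: "nat list \<Rightarrow> nat list \<Rightarrow> real" where
  "mzv_term as ks = (\<Prod>i<length as. 1 / real (ks ! i) ^ (as ! i))"

definition mzv :: "nat list \<Rightarrow> real" where
  "mzv as = infsum (mzv_term as)
     {ks. length ks = length as \<and> (\<forall>k\<in>set ks. 1 \<le> k) \<and> sorted_wrt (<) ks}"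

definition mzv_star :: "nat list \<Rightarrow> real" where
  "mzv_star as = infsum (mzv_term as)
     {ks. length ks = length as \<and> (\<forall>k\<in>set ks. 1 \<le> k) \<and> sorted_wrt (\<le>) ks}"

text \<open>The Riemann zeta function on the half-line \<open>s > 1\<close>, where its Dirichlet series converges.\<close>

definition riemann_zeta :: "real \<Rightarrow> real" where
  "riemann_zeta s = (\<Sum>n. 1 / real (Suc n) powr s)"

definition Z_minus :: "nat \<Rightarrow> real" where
  "Z_minus n = (\<Sum>(a, b)\<in>{(a, b). a + b = n}. (- 1) ^ b * mzv (replicate a 1 @ [b + 2]))"

definition Z_star_plus :: "nat \<Rightarrow> real" where
  "Z_star_plus n = (\<Sum>(a, b)\<in>{(a, b). a + b = n}. mzv_star (replicate a 1 @ [b + 2]))"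

end

theory Submission
  imports Defs
begin

text \<open>
  Summing over the exponents gives, for \<open>0 < x < 1\<close>,
  \<open>\<Sum>\<^sub>n Z\<^sub>-(n) x\<^sup>n = \<Sum>\<^sub>k\<^sub>\<ge>\<^sub>1 \<Prod>\<^sub>j\<^sub><\<^sub>k (1 + x/j) / (k (k + x))\<close>, and this is
  \<open>(F - 1) / x\<^sup>2\<close> for the Gauss series \<open>F = \<^sub>2F\<^sub>1(x, x; 1 + x; 1) = \<pi>x / sin \<pi>x\<close>. Likewise
  \<open>\<Sum>\<^sub>n Z\<^sup>\<star>\<^sub>+(n) x\<^sup>n = J(1 - x)\<close> with \<open>J(y) = \<Sum>\<^sub>k\<^sub>\<ge>\<^sub>0 B(k + 1, y) / (k + y)\<close>, and a telescoping argument
  gives \<open>J(y) + J(y + 1) = 2/y\<^sup>2\<close>, whence \<open>J(y) = 2 \<Sum>\<^sub>i (-1)\<^sup>i / (i + y)\<^sup>2\<close>.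

  With \<open>\<eta>(s) = (1 - 2\<^sup>1\<^sup>-\<^sup>s) \<zeta>(s)\<close> this means \<open>Z\<^sub>-(2m) = 2 \<eta>(2m + 2)\<close> and
  \<open>Z\<^sup>\<star>\<^sub>+(n) = 2 (n + 1) \<eta>(n + 2)\<close>. Symmetrising the sum under \<open>m \<leftrightarrow> p - m\<close> leaves the convolution
  of \<open>\<eta>\<close> at even arguments, which is read off from \<open>(\<pi>x / sin \<pi>x)\<^sup>2 = c - x c'\<close> for
  \<open>c = \<pi>x cot \<pi>x\<close>.
\<close>

subsection \<open>Power series on the unit interval\<close>

text \<open>By strong induction the coefficients below \<open>n\<close> vanish, so division by
  \<open>x ^ n\<close> leaves a power series with constant term \<open>a n\<close>; its limit from
  the right at 0 is both \<open>a n\<close> and 0. Only points of (0, 1) are tested, since the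
  generating functions below are evaluated only there.\<close>

lemma powser_eq_0_right:
  fixes a :: "nat \<Rightarrow> real"
  assumes "\<And>x. 0 < x \<Longrightarrow> x < 1 \<Longrightarrow> (\<lambda>n. a n * x ^ n) sums 0"
  shows "a n = 0"
proof (induction n rule: less_induct)
  case (less n)
  have s0: "(\<lambda>i. a (i + n) * x ^ i) sums 0" if x: "0 < x" "x < 1" for x
  proof -
    have "(\<lambda>i. a (i + n) * x ^ (i + n)) sums (0 - (\<Sum>i<n. a i * x ^ i))"
      using assms[OF x] by (subst sums_iff_shift) simp
    hence "(\<lambda>i. a (i + n) * x ^ (i + n) / x ^ n) sums ((0 - (\<Sum>i<n. a i * x ^ i)) / x ^ n)"
      by (rule sums_divide)
    thus ?thesis using x less by (simp add: power_add)
  qed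
  define f where "f x = (\<Sum>i. a (i + n) * x ^ i)" for x
  have "(f \<longlongrightarrow> a (0 + n)) (at 0)"
  proof (rule powser_limit_0[where s = "1/2"])
    \<comment> \<open>Convergence at the one point 1/2 gives convergence on both sides of 0, as the
      limit theorem requires.\<close>
    fix x :: real assume "norm x < 1/2"
    hence "summable (\<lambda>i. a (i + n) * x ^ i)"
      using powser_inside[of "\<lambda>i. a (i + n)" "1/2" x] s0[of "1/2"] by (auto simp: sums_iff)
    thus "(\<lambda>i. a (i + n) * x ^ i) sums f x" by (simp add: f_def summable_sums)
  qed simp
  hence "(f \<longlongrightarrow> a n) (at_right 0)" by (simp add: filterlim_at_split)
  moreover have "(f \<longlongrightarrow> 0) (at_right 0)"
  proof (rule tendsto_eventually)
    have "\<forall>\<^sub>F x in at_right 0. x \<in> {0<..<1::real}"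
      by (rule eventually_at_right_real) simp
    thus "\<forall>\<^sub>F x in at_right 0. f x = 0"
      by eventually_elim (use s0 in \<open>auto simp: f_def sums_iff\<close>)
  qed
  ultimately show ?case by (rule tendsto_unique[rotated]) simp
qed

lemma powser_unique_right:
  fixes a b :: "nat \<Rightarrow> real"
  assumes "\<And>x. 0 < x \<Longrightarrow> x < 1 \<Longrightarrow> (\<lambda>n. a n * x ^ n) sums f x"
    and "\<And>x. 0 < x \<Longrightarrow> x < 1 \<Longrightarrow> (\<lambda>n. b n * x ^ n) sums f x"
  shows "a = b"
proof
  fix n
  have "a n - b n = 0"
    by (rule powser_eq_0_right[of "\<lambda>n. a n - b n"])
       (use sums_diff[OF assms] in \<open>force simp: left_diff_distrib\<close>)
  thus "a n = b n" by simp
qed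

text \<open>Fubini: the nonnegative majorant \<open>d\<close> has a convergent iterated sum, so the
  double family is absolutely summable and may be summed in either order. A majorant separate from
  \<open>c\<close> allows coefficients of mixed sign, as in \<open>Z_minus\<close>.\<close>

lemma sums_powser_of_series:
  fixes c d :: "nat \<Rightarrow> nat \<Rightarrow> real"
  assumes x: "0 < x" and f: "\<And>k. (\<lambda>n. c k n * x ^ n) sums f k"
    and cd: "\<And>k n. \<bar>c k n\<bar> \<le> d k n"
    and g: "\<And>k. (\<lambda>n. d k n * x ^ n) sums g k" "summable g"
  shows "(\<lambda>n. (\<Sum>k. c k n) * x ^ n) sums (\<Sum>k. f k)"
proof -
  let ?a = "\<lambda>(k, n). c k n * x ^ n"
  have d0: "0 \<le> d k n" for k n using cd[of k n] by linarith
  have g0: "0 \<le> g k" for k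
    by (rule sums_le[OF _ sums_zero g(1)[of k]]) (use d0 x in auto)
  have gs: "((\<lambda>n. d k n * x ^ n) has_sum g k) UNIV" for k
    using g(1) d0 x by (intro sums_nonneg_imp_has_sum) auto
  have "(\<lambda>(k, n). d k n * x ^ n) summable_on (UNIV \<times> UNIV)"
  proof (rule summable_on_SigmaI[where g = g])
    show "g summable_on UNIV" using g(2) g0 by (rule summable_nonneg_imp_summable_on)
  qed (use gs d0 x in auto)
  hence abs: "(\<lambda>z. norm (?a z)) summable_on (UNIV \<times> UNIV)"
  proof (rule Infinite_Sum.summable_on_comparison_test)
    fix z show "norm (?a z) \<le> (case z of (k, n) \<Rightarrow> d k n * x ^ n)"
      using cd x by (auto simp: abs_mult intro!: mult_right_mono split: prod.split)
  qed auto
  hence sm: "?a summable_on (UNIV \<times> UNIV)" by (rule abs_summable_summable)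
  hence sm': "(\<lambda>(n, k). c k n * x ^ n) summable_on (UNIV \<times> UNIV)"
    by (subst (asm) summable_on_swap) simp
  have row: "((\<lambda>n. c k n * x ^ n) has_sum f k) UNIV" for k
  proof (rule norm_summable_imp_has_sum)
    show "summable (\<lambda>n. norm (c k n * x ^ n))"
      using g(1)[of k] by (rule summable_comparison_test'[OF sums_summable, where N = 0])
        (use cd x in \<open>auto simp: abs_mult intro!: mult_right_mono\<close>)
  qed (rule f)
  have total: "(?a has_sum infsum ?a (UNIV \<times> UNIV)) (UNIV \<times> UNIV)"
    using sm by (rule has_sum_infsum)
  have "(f has_sum infsum ?a (UNIV \<times> UNIV)) UNIV"
    by (rule has_sum_SigmaD[OF total]) (use row in auto)
  hence tf: "infsum ?a (UNIV \<times> UNIV) = suminf f"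
    using has_sum_imp_sums sums_unique by blast
  have col: "(\<lambda>k. c k n * x ^ n) summable_on UNIV" for n
    using summable_on_SigmaD1[OF sm', of n] by simp
  \<comment> \<open>Since \<open>x\<close> is nonzero, dividing by \<open>x ^ n\<close> shows that
    the column \<open>c k n\<close> is itself summable, so \<open>x ^ n\<close> can be pulled out of
    its sum.\<close>
  have colval: "((\<lambda>k. c k n * x ^ n) has_sum (\<Sum>k. c k n) * x ^ n) UNIV" for n
  proof -
    have "summable (\<lambda>k. c k n * x ^ n)" using col by (rule summable_on_imp_summable)
    hence "summable (\<lambda>k. c k n * x ^ n / x ^ n)" by (rule summable_divide)
    hence "summable (\<lambda>k. c k n)" using x by simp
    hence "(\<lambda>k. c k n * x ^ n) sums ((\<Sum>k. c k n) * x ^ n)"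
      by (intro sums_mult2 summable_sums)
    moreover have "(\<lambda>k. c k n * x ^ n) sums infsum (\<lambda>k. c k n * x ^ n) UNIV"
      using col by (intro has_sum_imp_sums has_sum_infsum)
    ultimately show ?thesis using col by (metis has_sum_infsum sums_unique2)
  qed
  have "((\<lambda>(n, k). c k n * x ^ n) has_sum suminf f) (UNIV \<times> UNIV)"
    using total[unfolded tf] by (subst (asm) has_sum_swap) simp
  hence "((\<lambda>n. (\<Sum>k. c k n) * x ^ n) has_sum suminf f) UNIV"
    by (rule has_sum_SigmaD) (use colval in auto)
  thus ?thesis by (rule has_sum_imp_sums)
qed

subsection \<open>Cotangent and cosecant\<close>

lemma Gamma_reflection_real:
  fixes x :: real
  shows "Gamma x * Gamma (1 - x) = pi / sin (pi * x)"
proof -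
  have "complex_of_real (Gamma x * Gamma (1 - x)) = complex_of_real (pi / sin (pi * x))"
    using Gamma_reflection_complex[of "of_real x"]
    by (simp add: Gamma_complex_of_real[symmetric] sin_of_real[symmetric])
  thus ?thesis by (subst (asm) of_real_eq_iff)
qed

text \<open>This is the logarithmic derivative of the Gamma reflection formula.\<close>

lemma Digamma_reflection_real:
  fixes x :: real
  assumes "0 < x" "x < 1"
  shows "Digamma (1 - x) - Digamma x = pi * cot (pi * x)"
proof -
  have s: "sin (pi * x) > 0" using assms by (intro sin_gt_zero) auto
  have nx: "x \<notin> \<int>\<^sub>\<le>\<^sub>0" "1 - x \<notin> \<int>\<^sub>\<le>\<^sub>0" using assms by (auto elim!: nonpos_Ints_cases)
  have "((\<lambda>x. Gamma x * Gamma (1 - x)) has_field_derivative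
     (Gamma x * Gamma (1 - x)) * (Digamma x - Digamma (1 - x))) (at x)"
    using nx by (auto intro!: derivative_eq_intros simp: algebra_simps)
  moreover have "((\<lambda>x. pi / sin (pi * x)) has_field_derivative
     - (pi / sin (pi * x)) * (pi * cot (pi * x))) (at x)"
    using s by (auto intro!: derivative_eq_intros simp: cot_def field_simps power2_eq_square)
  ultimately have "(pi / sin (pi * x)) * (Digamma x - Digamma (1 - x)) =
     - (pi / sin (pi * x)) * (pi * cot (pi * x))"
    unfolding Gamma_reflection_real by (rule DERIV_unique)
  hence "(pi / sin (pi * x)) * (Digamma x - Digamma (1 - x) + pi * cot (pi * x)) = 0"
    by (simp add: algebra_simps)
  thus ?thesis using s by simp
qed

text \<open>Termwise, this is \<open>x\<close> times the difference of the Digamma series at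
  \<open>1 + x\<close> and \<open>1 - x\<close>; the value follows from the recurrence and the
  reflection formula for Digamma.\<close>

lemma cot_partial_fractions:
  fixes x :: real
  assumes "0 < x" "x < 1"
  shows "(\<lambda>k. 2 * x\<^sup>2 / ((real k + 1)\<^sup>2 - x\<^sup>2)) sums (1 - pi * x * cot (pi * x))"
proof -
  have Dg: "(\<lambda>n. inverse (real (Suc n)) - inverse (z + real n)) sums (Digamma z + euler_mascheroni)"
    if "z \<noteq> 0" for z :: real
    using summable_Digamma[of z] that by (simp add: Digamma_def summable_sums)
  have "(\<lambda>n. x * ((inverse (real (Suc n)) - inverse (1 + x + real n)) -
          (inverse (real (Suc n)) - inverse (1 - x + real n)))) sums
        (x * ((Digamma (1 + x) + euler_mascheroni) - (Digamma (1 - x) + euler_mascheroni)))"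
    using assms by (intro sums_mult sums_diff Dg) auto
  also have "(\<lambda>n. x * ((inverse (real (Suc n)) - inverse (1 + x + real n)) -
          (inverse (real (Suc n)) - inverse (1 - x + real n)))) =
        (\<lambda>k. 2 * x\<^sup>2 / ((real k + 1)\<^sup>2 - x\<^sup>2))"
  proof
    fix k
    have "(real k + 1)\<^sup>2 - x\<^sup>2 = (1 + x + real k) * (1 - x + real k)"
      by (simp add: algebra_simps power2_eq_square)
    moreover have "inverse (1 - x + real k) - inverse (1 + x + real k) =
        2 * x / ((1 + x + real k) * (1 - x + real k))"
      using assms by (subst diff_frac_eq[of _ _ 1 1, folded inverse_eq_divide]) (auto simp: mult.commute)
    ultimately show "x * ((inverse (real (Suc k)) - inverse (1 + x + real k)) -
          (inverse (real (Suc k)) - inverse (1 - x + real k))) = 2 * x\<^sup>2 / ((real k + 1)\<^sup>2 - x\<^sup>2)"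
      by (simp add: power2_eq_square)
  qed
  also have "x * ((Digamma (1 + x) + euler_mascheroni) - (Digamma (1 - x) + euler_mascheroni)) =
      1 - pi * x * cot (pi * x)"
    using Digamma_plus1[of x] Digamma_reflection_real[of x] assms
    by (simp add: add.commute algebra_simps)
  finally show ?thesis .
qed

section \<open>Taylor coefficients of the cotangent and the cosecant\<close>

abbreviation zeta_nat :: "nat \<Rightarrow> real" where
  "zeta_nat n \<equiv> (\<Sum>k. 1 / real (Suc k) ^ n)"

text \<open>These are the Taylor coefficients of \<open>1 - pi * x * cot (pi * x)\<close> at
  0.\<close>

definition cot_coeff :: "nat \<Rightarrow> real" where
  "cot_coeff n = (if even n \<and> 2 \<le> n then 2 * zeta_nat n else 0)"

lemma summable_zeta_nat:
  assumes "2 \<le> n"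
  shows "summable (\<lambda>k. 1 / real (Suc k) ^ n)"
  using inverse_power_summable[OF assms, where 'a = real]
  by (subst summable_Suc_iff[where f = "\<lambda>k. 1 / real k ^ n"]) (simp add: inverse_eq_divide)

text \<open>Each partial fraction is a geometric series in \<open>(x / (k + 1))^2\<close>; the
  double series has nonnegative terms, so it is its own majorant when the order of summation is
  exchanged.\<close>

lemma sums_cot_coeff:
  assumes x: "0 < x" "x < 1"
  shows "(\<lambda>n. cot_coeff n * x ^ n) sums (1 - pi * x * cot (pi * x))"
proof -
  define c :: "nat \<Rightarrow> nat \<Rightarrow> real"
    where "c k n = (if even n \<and> 2 \<le> n then 2 * (1 / real (Suc k) ^ n) else 0)" for k n
  have c: "(\<lambda>n. c k n * x ^ n) sums (2 * x\<^sup>2 / ((real k + 1)\<^sup>2 - x\<^sup>2))" for k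
  proof -
    define q where "q = x / real (Suc k)"
    have q: "0 < q" "q < 1" using x by (auto simp: q_def field_simps)
    \<comment> \<open>Adding the series for \<open>q\<close> and \<open>-q\<close> keeps twice the
      even powers; the correction at \<open>n = 0\<close> removes the constant term.\<close>
    have "(\<lambda>n. q ^ n + (-q) ^ n - (if n = 0 then 2 else 0)) sums (1 / (1 - q) + 1 / (1 - (-q)) - 2)"
      using q by (intro sums_add sums_diff geometric_sums sums_If_finite_set[of "{0}", simplified])
        (auto simp: sums_single)
    also have "(\<lambda>n. q ^ n + (-q) ^ n - (if n = 0 then 2 else 0)) = (\<lambda>n. c k n * x ^ n)"
    proof
      fix n
      have "n = 1" if "odd n" "n < 2" for n :: nat using that by presburger
      moreover have "n = 0" if "even n" "n < 2" for n :: nat using that by presburger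
      ultimately show "q ^ n + (-q) ^ n - (if n = 0 then 2 else 0) = c k n * x ^ n"
        by (cases "n < 2"; cases "even n") (auto simp: c_def q_def power_divide power_minus_odd)
    qed
    also have "1 / (1 - q) + 1 / (1 - (-q)) - 2 = 2 * q\<^sup>2 / (1 - q\<^sup>2)"
    proof -
      have "1 - q\<^sup>2 = (1 - q) * (1 + q)" by (simp add: algebra_simps power2_eq_square)
      thus ?thesis using q by (auto simp: divide_simps power2_eq_square)
    qed
    also have "\<dots> = 2 * x\<^sup>2 / ((real k + 1)\<^sup>2 - x\<^sup>2)"
    proof -
      have "x\<^sup>2 < (real k + 1)\<^sup>2" using x by (intro power_strict_mono) auto
      hence "(real k + 1)\<^sup>2 - x\<^sup>2 \<noteq> 0" by simp
      thus ?thesis by (simp add: q_def power_divide field_simps)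
    qed
    finally show ?thesis .
  qed
  have "(\<lambda>n. (\<Sum>k. c k n) * x ^ n) sums (\<Sum>k. 2 * x\<^sup>2 / ((real k + 1)\<^sup>2 - x\<^sup>2))"
    by (rule sums_powser_of_series[OF x(1) c _ c])
       (use cot_partial_fractions[OF x] in \<open>auto simp: c_def sums_iff\<close>)
  also have "(\<lambda>n. \<Sum>k. c k n) = cot_coeff"
  proof
    fix n
    show "(\<Sum>k. c k n) = cot_coeff n"
    proof (cases "even n \<and> 2 \<le> n")
      case True
      hence "(\<Sum>k. c k n) = (\<Sum>k. 2 * (1 / real (Suc k) ^ n))" by (simp only: c_def if_True simp_thms)
      also have "\<dots> = 2 * zeta_nat n" using True by (intro suminf_mult summable_zeta_nat) simp
      finally show ?thesis using True by (simp only: cot_coeff_def if_True simp_thms)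
    qed (auto simp: c_def cot_coeff_def)
  qed
  finally show ?thesis using cot_partial_fractions[OF x] by (simp add: sums_iff)
qed

text \<open>These are the Taylor coefficients of \<open>pi * x / sin (pi * x) - 1\<close>. For even
  \<open>n\<close> with \<open>n \<ge> 2\<close> the value is twice the Dirichlet eta value at
  \<open>n\<close>.\<close>

definition csc_coeff :: "nat \<Rightarrow> real" where
  "csc_coeff n = (1 - 2 / 2 ^ n) * cot_coeff n"

text \<open>The identity \<open>cot y - cot (2 * y) = 1 / sin (2 * y)\<close> at
  \<open>y = pi * x / 2\<close> expresses the cosecant by two cotangents; halving \<open>x\<close>
  scales the coefficient of index \<open>n\<close> by \<open>1 / 2 ^ n\<close>.\<close>

lemma sums_csc_coeff:
  assumes x: "0 < x" "x < 1"
  shows "(\<lambda>n. csc_coeff n * x ^ n) sums (pi * x / sin (pi * x) - 1)"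
proof -
  have "(\<lambda>n. cot_coeff n * x ^ n - 2 * (cot_coeff n * (x / 2) ^ n)) sums
     ((1 - pi * x * cot (pi * x)) - 2 * (1 - pi * (x / 2) * cot (pi * (x / 2))))"
    using x by (intro sums_diff sums_mult sums_cot_coeff) auto
  also have "(\<lambda>n. cot_coeff n * x ^ n - 2 * (cot_coeff n * (x / 2) ^ n)) = (\<lambda>n. csc_coeff n * x ^ n)"
    by (auto simp: csc_coeff_def power_divide algebra_simps)
  also have "(1 - pi * x * cot (pi * x)) - 2 * (1 - pi * (x / 2) * cot (pi * (x / 2))) =
      pi * x / sin (pi * x) - 1"
  proof -
    define y where "y = pi * x / 2"
    have y: "pi * x = 2 * y" "pi * (x / 2) = y" by (auto simp: y_def)
    have s: "sin y > 0" unfolding y_def using x by (intro sin_gt_zero) auto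
    have co: "cos y > 0" unfolding y_def using x by (intro cos_gt_zero) auto
    have "cot (2 * y) = ((cos y)\<^sup>2 - (sin y)\<^sup>2) / (2 * sin y * cos y)"
      by (simp add: cot_def sin_double cos_double)
    moreover have "cot y = 2 * (cos y)\<^sup>2 / (2 * sin y * cos y)"
      using s co by (simp add: cot_def field_simps power2_eq_square)
    ultimately have "cot y - cot (2 * y) = ((cos y)\<^sup>2 + (sin y)\<^sup>2) / (2 * sin y * cos y)"
      by (simp only: diff_divide_distrib[symmetric]) (simp add: algebra_simps)
    hence "cot y - cot (2 * y) = 1 / sin (2 * y)"
      by (simp add: sin_double)
    hence "2 * y * (cot y - cot (2 * y)) = 2 * y / sin (2 * y)" by simp
    thus ?thesis unfolding y by (simp add: algebra_simps)
  qed
  finally show ?thesis .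
qed

text \<open>Both sides are Taylor coefficients of \<open>(pi * x / sin (pi * x) - 1)^2\<close>. The
  left one is the Cauchy square; the right one uses that, for
  \<open>g = 1 - pi * x * cot (pi * x)\<close>, the squared cosecant term equals
  \<open>1 - g + x * g'\<close>.\<close>

lemma csc_coeff_convolution:
  "(\<Sum>i\<le>n. csc_coeff i * csc_coeff (n - i)) = (real n - 1) * cot_coeff n - 2 * csc_coeff n"
proof -
  \<comment> \<open>Nonnegative coefficients make the convergence absolute, as the Cauchy product
    requires.\<close>
  have nonneg: "0 \<le> cot_coeff n" "0 \<le> csc_coeff n" for n
  proof -
    have "0 \<le> zeta_nat n" if "2 \<le> n" 
      using summable_zeta_nat[OF that] by (intro suminf_nonneg) auto
    thus *: "0 \<le> cot_coeff n" by (simp add: cot_coeff_def)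
    have "(2::real) / 2 ^ n \<le> 1" if "2 \<le> n"
      using that power_increasing[of 1 n "2::real"] by simp
    hence "0 \<le> 1 - (2::real) / 2 ^ n \<or> cot_coeff n = 0" by (auto simp: cot_coeff_def)
    thus "0 \<le> csc_coeff n" using * by (auto simp: csc_coeff_def)
  qed
  have "(\<lambda>n. (\<Sum>i\<le>n. csc_coeff i * csc_coeff (n - i)) * x ^ n) sums ((pi * x / sin (pi * x) - 1)\<^sup>2)"
    if x: "0 < x" "x < 1" for x
  proof -
    have sm: "summable (\<lambda>n. norm (csc_coeff n * x ^ n))"
      using sums_csc_coeff[OF x] nonneg x by (simp add: sums_iff abs_mult)
    have "(\<Sum>i\<le>n. csc_coeff i * x ^ i * (csc_coeff (n - i) * x ^ (n - i))) =
        (\<Sum>i\<le>n. csc_coeff i * csc_coeff (n - i)) * x ^ n" for n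
      unfolding sum_distrib_right by (intro sum.cong refl) (simp add: power_add[symmetric] mult_ac)
    thus ?thesis using Cauchy_product_sums[OF sm sm] sums_csc_coeff[OF x]
      by (simp add: sums_iff power2_eq_square)
  qed
  moreover have "(\<lambda>n. ((real n - 1) * cot_coeff n - 2 * csc_coeff n) * x ^ n) sums
      ((pi * x / sin (pi * x) - 1)\<^sup>2)" if x: "0 < x" "x < 1" for x
  proof -
    define g where "g x = (\<Sum>n. cot_coeff n * x ^ n)" for x
    have s: "sin (pi * x) > 0" using x by (intro sin_gt_zero) auto
    \<comment> \<open>Termwise differentiation needs convergence on the whole disc; it is inherited
      from a point \<open>w\<close> between \<open>norm z\<close> and 1.\<close>
    have sm: "summable (\<lambda>n. cot_coeff n * z ^ n)" if z: "norm z < 1" for z :: real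
    proof -
      obtain w where w: "norm z < w" "w < 1" using dense[OF z] by auto
      hence "0 < w" using norm_ge_zero[of z] by linarith
      thus ?thesis using powser_inside[OF sums_summable[OF sums_cot_coeff[of w]], of z] w by auto
    qed
    have "((\<lambda>x. 1 - pi * x * cot (pi * x)) has_field_derivative
        (- pi * cot (pi * x) + pi * x * pi / (sin (pi * x))\<^sup>2)) (at x)"
      using s by (auto intro!: derivative_eq_intros DERIV_cot[THEN DERIV_chain2]
        simp: field_simps power2_eq_square)
    moreover have "\<forall>\<^sub>F x in nhds x. 1 - pi * x * cot (pi * x) = g x"
    proof -
      have "\<forall>\<^sub>F x in nhds x. x \<in> {0<..<1}" using x by (intro eventually_nhds_in_open) auto
      thus ?thesis by eventually_elim (use sums_cot_coeff in \<open>auto simp: g_def sums_iff\<close>)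
    qed
    ultimately have "(g has_field_derivative (- pi * cot (pi * x) + pi * x * pi / (sin (pi * x))\<^sup>2)) (at x)"
      by (subst (asm) DERIV_cong_ev[OF refl _ refl]) auto
    hence "(\<lambda>n. diffs cot_coeff n * x ^ n) sums (- pi * cot (pi * x) + pi * x * pi / (sin (pi * x))\<^sup>2)"
      by (rule termdiffs_sums_strong[where K = 1, rotated])
         (use sm x in \<open>auto simp: g_def intro!: summable_sums\<close>)
    hence "(\<lambda>n. x * (diffs cot_coeff n * x ^ n)) sums
       (x * (- pi * cot (pi * x) + pi * x * pi / (sin (pi * x))\<^sup>2))" by (rule sums_mult)
    hence "(\<lambda>n. real (Suc n) * cot_coeff (Suc n) * x ^ Suc n) sums
       (x * (- pi * cot (pi * x) + pi * x * pi / (sin (pi * x))\<^sup>2))"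
      by (simp add: diffs_def mult_ac)
    hence "(\<lambda>n. real n * cot_coeff n * x ^ n) sums
       (x * (- pi * cot (pi * x) + pi * x * pi / (sin (pi * x))\<^sup>2))"
      by (subst (asm) sums_Suc_iff) simp
    hence "(\<lambda>n. real n * cot_coeff n * x ^ n - cot_coeff n * x ^ n - 2 * (csc_coeff n * x ^ n)) sums
       (x * (- pi * cot (pi * x) + pi * x * pi / (sin (pi * x))\<^sup>2) - (1 - pi * x * cot (pi * x))
         - 2 * (pi * x / sin (pi * x) - 1))"
      by (intro sums_diff sums_mult sums_cot_coeff sums_csc_coeff x)
    moreover have "x * (- pi * cot (pi * x) + pi * x * pi / (sin (pi * x))\<^sup>2) - (1 - pi * x * cot (pi * x))
         - 2 * (pi * x / sin (pi * x) - 1) = (pi * x / sin (pi * x) - 1)\<^sup>2"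
      using s by (simp add: field_simps power2_eq_square)
    ultimately show ?thesis by (simp add: algebra_simps)
  qed
  ultimately have "(\<lambda>n. \<Sum>i\<le>n. csc_coeff i * csc_coeff (n - i)) =
      (\<lambda>n. (real n - 1) * cot_coeff n - 2 * csc_coeff n)"
    by (rule powser_unique_right)
  thus ?thesis by (rule fun_cong)
qed

subsection \<open>A Gauss series\<close>

text \<open>A positive limit would bound \<open>a k\<close> below by a multiple of
  \<open>1 / k\<close>, against the divergence of the harmonic series. This disposes of the boundary
  terms in the telescoping sums below without asymptotics of the Gamma function.\<close>

lemma summable_imp_limit_mult_index_0:
  fixes a :: "nat \<Rightarrow> real"
  assumes "summable a" "\<And>k. 0 \<le> a k" "(\<lambda>k. real k * a k) \<longlonglongrightarrow> L"
  shows "L = 0"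
proof (rule ccontr)
  assume "L \<noteq> 0"
  moreover have "0 \<le> L" using assms(2) by (intro LIMSEQ_le_const[OF assms(3)]) auto
  ultimately have L: "L > 0" by simp
  hence "\<forall>\<^sub>F k in sequentially. L / 2 < real k * a k"
    by (intro order_tendstoD[OF assms(3)]) auto
  moreover have "\<forall>\<^sub>F k in sequentially. k > (0::nat)" by (rule eventually_gt_at_top)
  ultimately have "\<forall>\<^sub>F k in sequentially. norm (inverse (real k)) \<le> 2 / L * a k"
    by eventually_elim (use L in \<open>auto simp: field_simps\<close>)
  hence "summable (\<lambda>k. inverse (real k))"
    by (rule summable_comparison_test_ev) (intro summable_mult assms)
  thus False using not_summable_harmonic[where 'a = real] by simp
qed

section \<open>The terms of 2F1(x, x; c; 1) and their dependence on \<open>c\<close>\<close>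

lemma pochhammer_mono_left:
  fixes a b :: real
  assumes "0 \<le> a" "a \<le> b"
  shows "pochhammer a k \<le> pochhammer b k"
  unfolding pochhammer_prod using assms by (intro prod_mono) auto

text \<open>This is the term of index \<open>k\<close> of the hypergeometric series 2F1(x, x; c;
  1).\<close>

definition gauss_term :: "real \<Rightarrow> real \<Rightarrow> nat \<Rightarrow> real" where
  "gauss_term x c k = (pochhammer x k)\<^sup>2 / (pochhammer c k * fact k)"

lemma gauss_term_nonneg: "0 < c \<Longrightarrow> 0 \<le> gauss_term x c k"
  by (simp add: gauss_term_def pochhammer_pos less_imp_le)

lemma gauss_term_Suc:
  "gauss_term x c (Suc k) = gauss_term x c k * (x + real k)\<^sup>2 / ((c + real k) * (real k + 1))"
  by (simp add: gauss_term_def pochhammer_Suc power_mult_distrib mult_ac add_ac)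

lemma gauss_term_shift:
  assumes "0 < c"
  shows "gauss_term x (c + 1) k = gauss_term x c k * c / (c + real k)"
proof -
  have "c * pochhammer (c + 1) k = pochhammer c k * (c + real k)"
    by (metis pochhammer_Suc pochhammer_rec)
  hence "pochhammer (c + 1) k = pochhammer c k * (c + real k) / c"
    using assms by (simp add: field_simps)
  thus ?thesis using assms by (simp add: gauss_term_def)
qed

text \<open>After multiplication by \<open>c + k\<close> everything rests on the polynomial identity
  \<open>(c - 2*x) * (c + k) - (c - x)^2 = k * (c + k) - (x + k)^2\<close>. The right-hand side is
  arranged to telescope in \<open>k\<close>.\<close>

lemma gauss_term_contiguous:
  assumes c: "0 < c"
  shows "c * (c - 2 * x) * gauss_term x c k - (c - x)\<^sup>2 * gauss_term x (c + 1) k =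
    c * (real k * gauss_term x c k - real (Suc k) * gauss_term x c (Suc k))"
proof -
  let ?t = "gauss_term x c k"
  have nz: "c + real k \<noteq> 0" using c by linarith
  have "(c * (c - 2 * x) * ?t - (c - x)\<^sup>2 * gauss_term x (c + 1) k) * (c + real k) =
    c * ?t * ((c - 2 * x) * (c + real k) - (c - x)\<^sup>2)"
    unfolding gauss_term_shift[OF c] using nz by (simp add: field_simps)
  also have "(c - 2 * x) * (c + real k) - (c - x)\<^sup>2 = real k * (c + real k) - (x + real k)\<^sup>2"
    by (simp add: algebra_simps power2_eq_square)
  also have "real (Suc k) * gauss_term x c (Suc k) = ?t * (x + real k)\<^sup>2 / (c + real k)"
    unfolding gauss_term_Suc by (simp add: add.commute[of 1])
  hence "real (Suc k) * gauss_term x c (Suc k) * (c + real k) = ?t * (x + real k)\<^sup>2"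
    using nz by simp
  hence "c * ?t * (real k * (c + real k) - (x + real k)\<^sup>2) =
    c * (real k * ?t - real (Suc k) * gauss_term x c (Suc k)) * (c + real k)"
    by (simp only: left_diff_distrib right_diff_distrib mult.assoc) (simp only: mult_ac)
  finally show ?thesis using nz by simp
qed

text \<open>With \<open>v\<close> as below,
  \<open>v k - v (Suc k) = (1 - x) * v k / (k + 2)\<close>, so these terms telescope to partial sums
  of at most \<open>v 0\<close>; and \<open>k + 1 + x\<close> is at least
  \<open>(k + 2) / 2\<close>.\<close>

lemma summable_rising_ratio:
  fixes x :: real
  assumes x: "0 < x" "x < 1"
  shows "summable (\<lambda>k. pochhammer (1 + x) k / fact k / ((real k + 1) * (real k + 1 + x)))"
proof -
  define v where "v k = pochhammer (1 + x) k / fact k / (real k + 1)" for k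
  have v0: "0 \<le> v k" for k using x by (simp add: v_def pochhammer_nonneg)
  have dv: "v k - v (Suc k) = (1 - x) * (v k / (real k + 2))" for k
  proof -
    have "v (Suc k) = v k * ((1 + x + real k) / (real k + 2))"
      by (simp add: v_def pochhammer_Suc field_simps)
    moreover have "1 - (1 + x + real k) / (real k + 2) = (1 - x) / (real k + 2)"
      by (simp add: field_simps)
    ultimately have "v k - v (Suc k) = v k * ((1 - x) / (real k + 2))"
      by (metis mult.right_neutral right_diff_distrib)
    thus ?thesis by simp
  qed
  have "summable (\<lambda>k. (1 - x) * (v k / (real k + 2)))"
  proof (rule summableI_nonneg_bounded)
    fix n
    have "(\<Sum>k<n. (1 - x) * (v k / (real k + 2))) = v 0 - v n"
      unfolding dv[symmetric] by (rule sum_lessThan_telescope')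
    thus "(\<Sum>k<n. (1 - x) * (v k / (real k + 2))) \<le> v 0" using v0[of n] by simp
  qed (use x v0 in auto)
  hence "summable (\<lambda>k. 2 / (1 - x) * ((1 - x) * (v k / (real k + 2))))" by (rule summable_mult)
  thus ?thesis
  proof (rule summable_comparison_test'[where N = 0])
    fix k
    have "v k / (real k + 1 + x) \<le> v k / ((real k + 2) / 2)"
      using x v0 by (intro divide_left_mono) auto
    thus "norm (pochhammer (1 + x) k / fact k / ((real k + 1) * (real k + 1 + x)))
        \<le> 2 / (1 - x) * ((1 - x) * (v k / (real k + 2)))"
      using x v0[of k] by (simp add: v_def pochhammer_nonneg mult_ac)
  qed
qed

lemma gauss_term_Suc_eq:
  assumes "0 < x"
  shows "gauss_term x (1 + x) (Suc k) =
    x\<^sup>2 * (pochhammer (1 + x) k / fact k / ((real k + 1) * (real k + 1 + x)))"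
proof -
  have "pochhammer x (Suc k) = x * pochhammer (1 + x) k"
    by (simp add: pochhammer_rec add.commute)
  moreover have "pochhammer (1 + x) k > 0" using assms by (intro pochhammer_pos) auto
  ultimately show ?thesis using assms
    by (simp add: gauss_term_def pochhammer_Suc[of "1 + x"] power_mult_distrib power2_eq_square mult_ac add_ac)
qed

text \<open>The first factor of the Pochhammer symbol in the denominator alone supplies the gain
  \<open>(1 + x) / c\<close>, which makes the series without its leading term vanish as
  \<open>c\<close> grows. The term of index 0 equals 1 for every \<open>c\<close> and must be left
  out.\<close>

lemma gauss_term_le:
  assumes "0 < x" "1 + x \<le> c"
  shows "gauss_term x c (Suc k) \<le> (1 + x) / c * gauss_term x (1 + x) (Suc k)"
proof -
  have "c / (1 + x) * pochhammer (1 + x) (Suc k) \<le> pochhammer c (Suc k)"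
    using assms mult_left_mono[OF pochhammer_mono_left[of "1 + x + 1" "c + 1" k], of c]
    by (simp add: pochhammer_rec)
  moreover have "0 < pochhammer (1 + x) (Suc k)" using assms by (intro pochhammer_pos) auto
  ultimately have "(pochhammer x (Suc k))\<^sup>2 / (pochhammer c (Suc k) * fact (Suc k)) \<le>
     (pochhammer x (Suc k))\<^sup>2 / (c / (1 + x) * pochhammer (1 + x) (Suc k) * fact (Suc k))"
    using assms by (intro divide_left_mono mult_right_mono mult_pos_pos pochhammer_pos) auto
  also have "\<dots> = (1 + x) / c * gauss_term x (1 + x) (Suc k)"
    using assms by (simp add: gauss_term_def mult_ac)
  finally show ?thesis by (simp add: gauss_term_def)
qed

lemma summable_gauss_term:
  assumes x: "0 < x" "x < 1" and c: "1 + x \<le> c"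
  shows "summable (gauss_term x c)"
proof -
  have "summable (\<lambda>k. gauss_term x (1 + x) (Suc k))"
    unfolding gauss_term_Suc_eq[OF x(1)] by (intro summable_mult summable_rising_ratio x)
  hence "summable (\<lambda>k. (1 + x) / c * gauss_term x (1 + x) (Suc k))" by (rule summable_mult)
  hence "summable (\<lambda>k. gauss_term x c (Suc k))"
    by (rule summable_comparison_test'[where N = 0])
       (use gauss_term_le[OF x(1) c] gauss_term_nonneg[of c] x c in auto)
  thus ?thesis by (subst (asm) summable_Suc_iff)
qed

text \<open>Summing the telescoping relation shows that the boundary term
  \<open>k * gauss_term x c k\<close> has a limit; as the series converges, that limit is 0.\<close>

lemma suminf_gauss_term_contiguous:
  assumes x: "0 < x" "x < 1" and c: "1 + x \<le> c"
  shows "c * (c - 2 * x) * suminf (gauss_term x c) = (c - x)\<^sup>2 * suminf (gauss_term x (c + 1))"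
proof -
  let ?u = "\<lambda>k. real k * gauss_term x c k"
  have c0: "0 < c" using x c by simp
  have sm: "summable (gauss_term x c)" "summable (gauss_term x (c + 1))"
    using x c by (auto intro!: summable_gauss_term)
  define D where "D = c * (c - 2 * x) * suminf (gauss_term x c) - (c - x)\<^sup>2 * suminf (gauss_term x (c + 1))"
  have "(\<lambda>k. c * (c - 2 * x) * gauss_term x c k - (c - x)\<^sup>2 * gauss_term x (c + 1) k) sums D"
    unfolding D_def by (intro sums_diff sums_mult summable_sums sm)
  hence "(\<lambda>k. c * (?u k - ?u (Suc k)) / c) sums (D / c)"
    unfolding gauss_term_contiguous[OF c0] by (rule sums_divide)
  hence "(\<lambda>n. \<Sum>k<n. ?u k - ?u (Suc k)) \<longlonglongrightarrow> D / c" using c0 by (simp add: sums_def)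
  hence "(\<lambda>n. ?u 0 - ?u n) \<longlonglongrightarrow> D / c" unfolding sum_lessThan_telescope'[of ?u] .
  hence "(\<lambda>n. - (?u 0 - ?u n)) \<longlonglongrightarrow> - (D / c)" by (rule tendsto_minus)
  hence "?u \<longlonglongrightarrow> - (D / c)" by simp
  hence "- (D / c) = 0"
    by (rule summable_imp_limit_mult_index_0[OF sm(1) gauss_term_nonneg[OF c0]])
  thus ?thesis using c0 by (simp add: D_def)
qed

text \<open>Gauss's evaluation of \<open>\<^sub>2F\<^sub>1(x, x; 1 + x; 1)\<close>: shifting the lower parameter by one
  multiplies the value by one factor of the sine product.\<close>

lemma sums_gauss_term:
  assumes x: "0 < x" "x < 1"
  shows "gauss_term x (1 + x) sums (pi * x / sin (pi * x))"
proof -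
  define S where "S n = suminf (gauss_term x (1 + x + real n))" for n
  have step: "S n * (1 - x\<^sup>2 / (real (Suc n))\<^sup>2) = S (Suc n)" for n
  proof -
    have "(1 + x + real n) * (1 + x + real n - 2 * x) * S n = (1 + real n)\<^sup>2 * S (Suc n)"
      using suminf_gauss_term_contiguous[OF x, of "1 + x + real n"] by (simp add: S_def add_ac)
    also have "(1 + x + real n) * (1 + x + real n - 2 * x) = (1 + real n)\<^sup>2 - x\<^sup>2"
      by (simp add: algebra_simps power2_eq_square)
    finally show ?thesis by (simp add: field_simps)
  qed
  have prod: "S 0 * (\<Prod>k=1..n. 1 - x\<^sup>2 / (real k)\<^sup>2) = S n" for n
    by (induction n) (simp_all add: step[symmetric] mult_ac)
  have gs: "(\<lambda>k. gauss_term x (1 + x + real n) (Suc k)) sums (S n - 1)" for n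
    using summable_sums[OF summable_gauss_term[OF x, of "1 + x + real n"]] x
    by (subst sums_Suc_iff) (simp add: S_def gauss_term_def)
  \<comment> \<open>The leading term is 1, and the rest is nonnegative and of order
    \<open>1 / n\<close>, so \<open>S n\<close> tends to 1. Letting \<open>n\<close> grow in
    \<open>prod\<close> then makes \<open>S 0\<close> the reciprocal of Euler's sine
    product.\<close>
  have "1 \<le> S n" for n
    using sums_le[OF _ sums_zero gs[of n]] gauss_term_nonneg[of "1 + x + real n"] x by simp
  moreover have "S n \<le> 1 + (1 + x) * (S 0 - 1) / (1 + x + real n)" for n
  proof -
    have "S n - 1 \<le> (1 + x) / (1 + x + real n) * (S 0 - 1)"
      by (rule sums_le[OF _ gs[of n] sums_mult[OF gs[of 0]]])
         (use gauss_term_le[OF x(1), of "1 + x + real n"] in simp)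
    thus ?thesis by simp
  qed
  moreover have "(\<lambda>n. 1 + (1 + x) * (S 0 - 1) / (1 + x + real n)) \<longlonglongrightarrow> 1 + 0"
    by (intro tendsto_add tendsto_const tendsto_divide_0[OF tendsto_const]
        filterlim_at_top_imp_at_infinity filterlim_tendsto_add_at_top[OF tendsto_const]
        filterlim_real_sequentially)
  ultimately have "S \<longlonglongrightarrow> 1"
    by (intro real_tendsto_sandwich[where f = "\<lambda>_. 1" and g = S]) auto
  moreover have "(\<lambda>n. S 0 * (\<Prod>k=1..n. 1 - x\<^sup>2 / (real k)\<^sup>2)) \<longlonglongrightarrow> S 0 * (sin (pi * x) / (pi * x))"
    using sin_product_formula_real'[of x] x by (intro tendsto_mult tendsto_const) auto
  ultimately have "S 0 * (sin (pi * x) / (pi * x)) = 1"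
    unfolding prod by (intro LIMSEQ_unique)
  moreover have "sin (pi * x) > 0" using x by (intro sin_gt_zero) auto
  ultimately have "S 0 = pi * x / sin (pi * x)" using x by (simp add: field_simps)
  thus ?thesis using summable_sums[OF summable_gauss_term[OF x, of "1 + x"]] by (simp add: S_def)
qed

lemma sums_rising_ratio:
  fixes x :: real
  assumes x: "0 < x" "x < 1"
  shows "(\<lambda>k. pochhammer (1 + x) k / fact k / ((real k + 1) * (real k + 1 + x))) sums
    ((pi * x / sin (pi * x) - 1) / x\<^sup>2)"
proof -
  have "(\<lambda>k. gauss_term x (1 + x) (Suc k)) sums (pi * x / sin (pi * x) - 1)"
    using sums_gauss_term[OF x] by (subst sums_Suc_iff) (simp add: gauss_term_def)
  hence "(\<lambda>k. gauss_term x (1 + x) (Suc k) / x\<^sup>2) sums ((pi * x / sin (pi * x) - 1) / x\<^sup>2)"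
    by (rule sums_divide)
  thus ?thesis using x by (simp add: gauss_term_Suc_eq)
qed

subsection \<open>A series of Beta values\<close>

text \<open>This is the Beta function value \<open>B(k + 1, y)\<close>.\<close>

definition beta_nat :: "real \<Rightarrow> nat \<Rightarrow> real" where
  "beta_nat y k = fact k / pochhammer y (Suc k)"

lemma beta_nat_pos: "0 < y \<Longrightarrow> 0 < beta_nat y k"
  by (simp add: beta_nat_def pochhammer_pos)

lemma beta_nat_Suc: "beta_nat y (Suc k) = beta_nat y k * (real k + 1) / (real k + 1 + y)"
  by (simp add: beta_nat_def pochhammer_Suc[of y "Suc k"] add_ac)

lemma beta_nat_shift:
  assumes "0 < y"
  shows "beta_nat (y + 1) k = beta_nat y k * y / (real k + 1 + y)"
proof -
  have "y * pochhammer (y + 1) (Suc k) = pochhammer y (Suc k) * (real k + 1 + y)"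
    by (metis pochhammer_Suc pochhammer_rec of_nat_Suc add.commute)
  hence "pochhammer (y + 1) (Suc k) = pochhammer y (Suc k) * (real k + 1 + y) / y"
    using assms by (simp add: field_simps)
  thus ?thesis using assms by (simp add: beta_nat_def)
qed

text \<open>Consecutive values \<open>beta_nat y k\<close> differ by \<open>y\<close> times the
  summand, so the series telescopes from \<open>beta_nat y 0 = 1 / y\<close>; what remains is that
  \<open>beta_nat y\<close> tends to 0.\<close>

lemma sums_beta_nat_divide:
  assumes y: "0 < y"
  shows "(\<lambda>k. beta_nat y k / (real k + 1 + y)) sums (1 / y\<^sup>2)"
proof -
  have pos: "0 < beta_nat y k" for k by (rule beta_nat_pos[OF y])
  have d: "beta_nat y k - beta_nat y (Suc k) = y * (beta_nat y k / (real k + 1 + y))" for k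
  proof -
    have "real k + 1 + y \<noteq> 0" using y by linarith
    thus ?thesis by (simp add: beta_nat_Suc field_simps)
  qed
  have tel: "(\<Sum>k<n. y * (beta_nat y k / (real k + 1 + y))) = 1 / y - beta_nat y n" for n
    unfolding d[symmetric] sum_lessThan_telescope' by (simp add: beta_nat_def)
  have "summable (\<lambda>k. y * (beta_nat y k / (real k + 1 + y)))"
    by (rule summableI_nonneg_bounded[where x = "1 / y"])
       (use y pos in \<open>auto simp: tel less_imp_le simp del: times_divide_eq_right\<close>)
  then obtain T where T: "(\<lambda>k. y * (beta_nat y k / (real k + 1 + y))) sums T"
    by (auto simp: summable_def)
  hence "(\<lambda>n. 1 / y - beta_nat y n) \<longlonglongrightarrow> T" unfolding sums_def tel .
  hence "(\<lambda>n. 1 / y - (1 / y - beta_nat y n)) \<longlonglongrightarrow> 1 / y - T" by (intro tendsto_diff tendsto_const)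
  hence lim: "beta_nat y \<longlonglongrightarrow> 1 / y - T" by simp
  define A where "A k = beta_nat y k / (real k + 1 + y)" for k
  have A: "summable A"
    using sums_summable[OF sums_divide[OF T, of y]] y by (simp add: A_def[abs_def])
  \<comment> \<open>Since \<open>beta_nat y k = (k + 1 + y) * A k\<close> and \<open>A\<close> tends
    to 0, the limit of \<open>beta_nat y\<close> is also that of \<open>k * A k\<close>, which must
    be 0.\<close>
  have "(\<lambda>k. beta_nat y k - (1 + y) * A k) \<longlonglongrightarrow> 1 / y - T - (1 + y) * 0"
    by (intro tendsto_diff tendsto_mult tendsto_const lim summable_LIMSEQ_zero A)
  moreover have "beta_nat y k - (1 + y) * A k = real k * A k" for k
  proof -
    have "real k + 1 + y \<noteq> 0" using y by linarith
    hence "beta_nat y k = (real k + 1 + y) * A k" by (simp add: A_def)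
    thus ?thesis by (simp add: algebra_simps)
  qed
  ultimately have "1 / y - T = 0"
    using y pos by (intro summable_imp_limit_mult_index_0[OF A]) (auto simp: A_def less_imp_le)
  hence "T = 1 / y" by simp
  thus ?thesis using sums_divide[OF T, of y] y by (simp add: power2_eq_square)
qed

lemma summable_beta_nat:
  assumes y: "0 < y"
  shows "summable (\<lambda>k. beta_nat y k / (real k + y))"
proof -
  have "summable (\<lambda>k. beta_nat y (Suc k) / (real (Suc k) + y))"
  proof (rule summable_comparison_test'[where N = 0])
    show "summable (\<lambda>k. beta_nat y k / (real k + 1 + y))"
      using sums_beta_nat_divide[OF y] by (rule sums_summable)
    fix k
    have "beta_nat y (Suc k) \<le> beta_nat y k"
      unfolding beta_nat_Suc using y beta_nat_pos[OF y, of k]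
      by (simp add: divide_le_eq mult_left_mono)
    thus "norm (beta_nat y (Suc k) / (real (Suc k) + y)) \<le> beta_nat y k / (real k + 1 + y)"
      using y beta_nat_pos[OF y, of "Suc k"] by (simp add: add_ac divide_right_mono)
  qed
  thus ?thesis by (subst (asm) summable_Suc_iff)
qed

text \<open>Shift the first series by one, splitting off its initial term \<open>1 / y^2\<close>.
  With \<open>s = k + 1 + y\<close> the two summands carry the weights \<open>(s - y) / s\<close>
  and \<open>y / s\<close>, which add to 1, leaving the series summed in
  \<open>sums_beta_nat_divide\<close>.\<close>

lemma suminf_beta_nat_add:
  assumes y: "0 < y"
  shows "(\<Sum>k. beta_nat y k / (real k + y)) + (\<Sum>k. beta_nat (y + 1) k / (real k + (y + 1))) = 2 / y\<^sup>2"
proof -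
  let ?J = "\<lambda>y. \<Sum>k. beta_nat y k / (real k + y)"
  have "(\<lambda>k. beta_nat y (Suc k) / (real (Suc k) + y)) sums (?J y - beta_nat y 0 / y)"
    using summable_sums[OF summable_beta_nat[OF y]] by (subst sums_Suc_iff) simp
  moreover have "(\<lambda>k. beta_nat (y + 1) k / (real k + (y + 1))) sums ?J (y + 1)"
    using summable_beta_nat[of "y + 1"] y by (intro summable_sums) auto
  ultimately have "(\<lambda>k. beta_nat y (Suc k) / (real (Suc k) + y) +
      beta_nat (y + 1) k / (real k + (y + 1))) sums (?J y - beta_nat y 0 / y + ?J (y + 1))"
    by (rule sums_add)
  also have "(\<lambda>k. beta_nat y (Suc k) / (real (Suc k) + y) + beta_nat (y + 1) k / (real k + (y + 1))) =
      (\<lambda>k. beta_nat y k / (real k + 1 + y))"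
  proof
    fix k
    define s where "s = real k + 1 + y"
    have s: "s \<noteq> 0" "real (Suc k) + y = s" "real k + (y + 1) = s" "real k + 1 = s - y"
      using y by (auto simp: s_def)
    show "beta_nat y (Suc k) / (real (Suc k) + y) + beta_nat (y + 1) k / (real k + (y + 1)) =
        beta_nat y k / (real k + 1 + y)"
      unfolding beta_nat_Suc beta_nat_shift[OF y] s(2,3) s_def[symmetric] s(4)
      using s(1) by (simp add: field_simps)
  qed
  finally have "?J y - beta_nat y 0 / y + ?J (y + 1) = 1 / y\<^sup>2"
    using sums_beta_nat_divide[OF y] by (rule sums_unique2)
  thus ?thesis by (simp add: beta_nat_def power2_eq_square)
qed

text \<open>Iterating the functional equation from \<open>y\<close> to \<open>y + n\<close> leaves
  the remainder \<open>(-1) ^ n * J n\<close>, and \<open>J n\<close> lies between 0 and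
  \<open>2 / (n + y)^2\<close>.\<close>

lemma sums_alternating_beta_nat:
  assumes y: "0 < y"
  shows "(\<lambda>i. 2 * (-1) ^ i / (real i + y)\<^sup>2) sums (\<Sum>k. beta_nat y k / (real k + y))"
proof -
  define J where "J n = (\<Sum>k. beta_nat (real n + y) k / (real k + (real n + y)))" for n :: nat
  have J0: "0 \<le> J n" for n
    unfolding J_def using y beta_nat_pos[of "real n + y"]
    by (intro suminf_nonneg summable_beta_nat) (auto simp: less_imp_le)
  have step: "J n + J (Suc n) = 2 / (real n + y)\<^sup>2" for n
    using suminf_beta_nat_add[of "real n + y"] y by (simp add: J_def add_ac)
  have part: "(\<Sum>i<n. 2 * (-1) ^ i / (real i + y)\<^sup>2) = J 0 - (-1) ^ n * J n" for n
  proof (induction n)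
    case (Suc n)
    have "2 * (-1) ^ n / (real n + y)\<^sup>2 = (-1) ^ n * (J n + J (Suc n))" by (simp add: step)
    thus ?case using Suc by (simp add: algebra_simps)
  qed simp
  have "J \<longlonglongrightarrow> 0"
  proof (rule real_tendsto_sandwich[where f = "\<lambda>_. 0"])
    show "\<forall>\<^sub>F n in sequentially. J n \<le> 2 / (real n + y)\<^sup>2"
      using step J0 by (intro always_eventually allI) (smt (verit))
    show "(\<lambda>n. 2 / (real n + y)\<^sup>2) \<longlonglongrightarrow> 0"
      by (intro tendsto_divide_0[OF tendsto_const] filterlim_at_top_imp_at_infinity
          filterlim_pow_at_top filterlim_at_top_add_at_top filterlim_real_sequentially
          filterlim_tendsto_add_at_top[OF tendsto_const, of _ _ y, unfolded add.commute[of y]]) simp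
  qed (use J0 in auto)
  hence "(\<lambda>n. (-1) ^ n * J n) \<longlonglongrightarrow> 0"
    by (subst tendsto_rabs_zero_iff[symmetric]) (simp add: abs_mult tendsto_rabs_zero_iff)
  hence "(\<lambda>n. J 0 - (-1) ^ n * J n) \<longlonglongrightarrow> J 0 - 0" by (intro tendsto_diff tendsto_const)
  thus ?thesis by (simp add: sums_def part J_def)
qed

subsection \<open>Multiple harmonic sums with unit exponents\<close>

text \<open>With \<open>R\<close> one of \<open><\<close> and \<open>\<le>\<close>, these are the \<open>a\<close>-tuples that may precede a last entry \<open>k + 1\<close>.\<close>

definition chains :: "(nat \<Rightarrow> nat \<Rightarrow> bool) \<Rightarrow> nat \<Rightarrow> nat \<Rightarrow> nat list set" where
  "chains R a k = {ks. length ks = a \<and> (\<forall>i\<in>set ks. 1 \<le> i \<and> R i (Suc k)) \<and> sorted_wrt R ks}"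

text \<open>For \<open><\<close> this is the elementary symmetric polynomial of degree
  \<open>a\<close> in 1, 1/2, ..., 1/k; for \<open>\<le>\<close> it is the complete homogeneous one
  in 1, 1/2, ..., 1/(k+1).\<close>

definition chain_sum :: "(nat \<Rightarrow> nat \<Rightarrow> bool) \<Rightarrow> nat \<Rightarrow> nat \<Rightarrow> real" where
  "chain_sum R a k = (\<Sum>ks\<in>chains R a k. mzv_term (replicate a 1) ks)"

lemma mzv_term_snoc:
  assumes "length ks = length as"
  shows "mzv_term (as @ [b]) (ks @ [k]) = mzv_term as ks * (1 / real k ^ b)"
proof -
  have "(\<Prod>i<length as. 1 / real ((ks @ [k]) ! i) ^ ((as @ [b]) ! i)) = mzv_term as ks"
    unfolding mzv_term_def using assms by (intro prod.cong) (auto simp: nth_append)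
  thus ?thesis using assms by (simp add: mzv_term_def nth_append)
qed

lemma mzv_term_nonneg: "0 \<le> mzv_term as ks"
  by (auto simp: mzv_term_def intro!: prod_nonneg)

text \<open>Strict and weak chains are treated together: the first property makes the sets of chains
  finite, the second lets a chain be extended past its last entry.\<close>

locale index_order =
  fixes R :: "nat \<Rightarrow> nat \<Rightarrow> bool"
  assumes R_le: "R i j \<Longrightarrow> i \<le> j" and R_trans: "R i j \<Longrightarrow> R j k \<Longrightarrow> R i k"
begin

lemma finite_chains: "finite (chains R a k)"
proof (rule finite_subset)
  show "chains R a k \<subseteq> {ks. set ks \<subseteq> {..Suc k} \<and> length ks = a}"
    by (auto simp: chains_def dest: R_le)
qed (rule finite_lists_length_eq, simp)

lemma chain_sum_nonneg: "0 \<le> chain_sum R a k"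
  unfolding chain_sum_def by (intro sum_nonneg mzv_term_nonneg)

lemma chain_sum_0: "chain_sum R 0 k = 1"
proof -
  have "chains R 0 k = {[]}" by (auto simp: chains_def)
  thus ?thesis by (simp add: chain_sum_def mzv_term_def)
qed

text \<open>Split off the last entry \<open>Suc m\<close>. By transitivity, entries related to
  \<open>Suc m\<close> are also related to \<open>Suc k\<close>.\<close>

lemma chain_sum_Suc:
  "chain_sum R (Suc a) k = (\<Sum>m | R (Suc m) (Suc k). chain_sum R a m / real (Suc m))"
proof -
  let ?M = "{m. R (Suc m) (Suc k)}"
  have "?M \<subseteq> {..k}" using R_le by fastforce
  hence fin: "finite ?M" by (rule finite_subset) simp
  have "(\<Sum>m\<in>?M. chain_sum R a m / real (Suc m)) =
      (\<Sum>m\<in>?M. \<Sum>ks\<in>chains R a m. mzv_term (replicate a 1) ks / real (Suc m))"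
    by (simp add: chain_sum_def sum_divide_distrib)
  also have "\<dots> = (\<Sum>(m, ks)\<in>Sigma ?M (chains R a). mzv_term (replicate a 1) ks / real (Suc m))"
    using fin finite_chains by (subst sum.Sigma) auto
  also have "\<dots> = (\<Sum>ks\<in>chains R (Suc a) k. mzv_term (replicate (Suc a) 1) ks)"
  proof (rule sum.reindex_bij_witness[where i = "\<lambda>ks. (last ks - 1, butlast ks)"
        and j = "\<lambda>(m, ks). ks @ [Suc m]"])
    fix ks assume ks: "ks \<in> chains R (Suc a) k"
    then obtain us u where u: "ks = us @ [u]" by (cases ks rule: rev_cases) (auto simp: chains_def)
    thus "(last ks - 1, butlast ks) \<in> Sigma ?M (chains R a)"
      "(case (last ks - 1, butlast ks) of (m, ks) \<Rightarrow> ks @ [Suc m]) = ks"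
      using ks by (auto simp: chains_def sorted_wrt_append)
  next
    fix z assume "z \<in> Sigma ?M (chains R a)"
    then obtain m ks where z: "z = (m, ks)" "R (Suc m) (Suc k)" "ks \<in> chains R a m" by auto
    show "(case z of (m, ks) \<Rightarrow> ks @ [Suc m]) \<in> chains R (Suc a) k"
      using z R_trans by (auto simp: chains_def sorted_wrt_append)
    have "mzv_term (replicate a 1 @ [1]) (ks @ [Suc m]) = mzv_term (replicate a 1) ks * (1 / real (Suc m) ^ 1)"
      using z by (intro mzv_term_snoc) (auto simp: chains_def)
    moreover have "replicate (Suc a) (1::nat) = replicate a 1 @ [1]"
      by (simp add: replicate_append_same)
    ultimately show "mzv_term (replicate (Suc a) 1) (case z of (m, ks) \<Rightarrow> ks @ [Suc m]) =
        (case z of (m, ks) \<Rightarrow> mzv_term (replicate a 1) ks / real (Suc m))"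
      using z(1) by (simp only: prod.case power_one_right) simp
  qed auto
  finally show ?thesis by (simp add: chain_sum_def)
qed

text \<open>Splitting off the last entry \<open>Suc k\<close> turns the unordered sum into an
  iterated one with finite inner sums; the terms are nonnegative, so summability of the outer series
  suffices.\<close>

lemma infsum_mzv_term:
  assumes "summable (\<lambda>k. chain_sum R a k / real (Suc k) ^ b)"
  shows "infsum (mzv_term (replicate a 1 @ [b]))
      {ks. length ks = length (replicate a (1::nat) @ [b]) \<and> (\<forall>k\<in>set ks. 1 \<le> k) \<and> sorted_wrt R ks} =
    (\<Sum>k. chain_sum R a k / real (Suc k) ^ b)"
    (is "infsum ?t ?S = ?s")
proof (rule infsumI)
  let ?f = "\<lambda>(k, ks). mzv_term (replicate a 1) ks * (1 / real (Suc k) ^ b)"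
  have row: "((\<lambda>ks. ?f (k, ks)) has_sum (chain_sum R a k / real (Suc k) ^ b)) (chains R a k)" for k
    using has_sum_finite[OF finite_chains[of a k], of "\<lambda>ks. ?f (k, ks)"]
    by (simp add: chain_sum_def sum_divide_distrib)
  have tot: "((\<lambda>k. chain_sum R a k / real (Suc k) ^ b) has_sum ?s) UNIV"
    using summable_sums[OF assms] chain_sum_nonneg by (intro sums_nonneg_imp_has_sum) auto
  have "?f summable_on Sigma UNIV (chains R a)"
    using row by (rule summable_on_SigmaI)
      (use tot mzv_term_nonneg in \<open>auto simp: summable_on_def\<close>)
  hence "(?f has_sum ?s) (Sigma UNIV (chains R a))"
    using row tot by (intro has_sum_SigmaI) auto
  also have "?this \<longleftrightarrow> (?t has_sum ?s) ?S"
  proof (rule has_sum_reindex_bij_witness[where i = "\<lambda>ks. (last ks - 1, butlast ks)"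
        and j = "\<lambda>(k, ks). ks @ [Suc k]"])
    fix ks assume ks: "ks \<in> ?S"
    then obtain us u where u: "ks = us @ [u]" by (cases ks rule: rev_cases) auto
    thus "(last ks - 1, butlast ks) \<in> Sigma UNIV (chains R a)"
      "(case (last ks - 1, butlast ks) of (k, ks) \<Rightarrow> ks @ [Suc k]) = ks"
      using ks by (auto simp: chains_def sorted_wrt_append)
  next
    fix z assume "z \<in> Sigma UNIV (chains R a)"
    then obtain k ks where z: "z = (k, ks)" "ks \<in> chains R a k" by auto
    show "(case z of (k, ks) \<Rightarrow> ks @ [Suc k]) \<in> ?S"
      using z by (auto simp: chains_def sorted_wrt_append)
    show "?t (case z of (k, ks) \<Rightarrow> ks @ [Suc k]) = ?f z"
      using z by (simp add: mzv_term_snoc chains_def del: of_nat_Suc)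
  qed auto
  finally show "(?t has_sum ?s) ?S" .
qed

end

interpretation strict: index_order "(<)" by standard auto
interpretation weak: index_order "(\<le>)" by standard auto

text \<open>The generating function of the elementary symmetric polynomials is the product of
  \<open>1 + x / j\<close> for \<open>j\<close> from 1 to \<open>k\<close>. It is a polynomial in
  \<open>x\<close>, so \<open>x\<close> may be any real number.\<close>

lemma sums_chain_sum_strict:
  "(\<lambda>a. chain_sum (<) a k * x ^ a) sums (pochhammer (1 + x) k / fact k)"
proof (induction k)
  case 0
  have "chain_sum (<) a 0 * x ^ a = (if a = 0 then 1 else 0)" for a
    by (cases a) (auto simp: strict.chain_sum_0 strict.chain_sum_Suc)
  thus ?case using sums_single[of 0 "\<lambda>_. 1::real"] by simp
next
  case (Suc k)
  let ?f = "\<lambda>k a. chain_sum (<) a k * x ^ a" and ?s = "pochhammer (1 + x) k / fact k"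
  \<comment> \<open>The additional chains are those ending in \<open>Suc k\<close>; their other
    entries are smaller.\<close>
  have rec: "chain_sum (<) (Suc a) (Suc k) = chain_sum (<) (Suc a) k + chain_sum (<) a k / real (Suc k)" for a
  proof -
    have "{m. Suc m < Suc (Suc k)} = insert k {m. Suc m < Suc k}" by auto
    thus ?thesis by (simp add: strict.chain_sum_Suc)
  qed
  have "(\<lambda>a. ?f k (Suc a)) sums (?s - 1)"
    using Suc by (subst sums_Suc_iff) (simp add: strict.chain_sum_0)
  hence "(\<lambda>a. ?f k (Suc a) + x / real (Suc k) * ?f k a) sums (?s - 1 + x / real (Suc k) * ?s)"
    using Suc by (intro sums_add sums_mult)
  hence "(\<lambda>a. ?f (Suc k) (Suc a)) sums (?s - 1 + x / real (Suc k) * ?s)"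
    by (rule back_subst[where P = "\<lambda>f. f sums _"]) (simp add: rec field_simps)
  hence "?f (Suc k) sums (?s - 1 + x / real (Suc k) * ?s + ?f (Suc k) 0)"
    by (subst (asm) sums_Suc_iff)
  also have "?s - 1 + x / real (Suc k) * ?s + ?f (Suc k) 0 = ?s * (1 + x / real (Suc k))"
    unfolding strict.chain_sum_0 power_0
    by (simp only: distrib_left mult.commute[of "x / real (Suc k)"])
  also have "1 + x / real (Suc k) = (1 + x + real k) / real (Suc k)" by (simp add: field_simps)
  finally show ?case by (simp add: pochhammer_Suc mult_ac)
qed

text \<open>The generating function of the complete homogeneous polynomials is the product of
  \<open>1 / (1 - x / j)\<close> for \<open>j\<close> from 1 to \<open>k + 1\<close>. The next index
  \<open>k + 2\<close> may be repeated, so it contributes a whole geometric series in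
  \<open>q\<close>.\<close>

lemma sums_chain_sum_weak:
  assumes x: "0 < x" "x < 1"
  shows "(\<lambda>a. chain_sum (\<le>) a k * x ^ a) sums (fact (Suc k) / pochhammer (1 - x) (Suc k))"
proof (induction k)
  case 0
  have "chain_sum (\<le>) a 0 = 1" for a
  proof (induction a)
    case (Suc a)
    have "{m. Suc m \<le> Suc 0} = {0}" by auto
    thus ?case using Suc by (simp add: weak.chain_sum_Suc)
  qed (simp add: weak.chain_sum_0)
  thus ?case using geometric_sums[of x] x by simp
next
  case (Suc k)
  define q where "q = x / real (Suc (Suc k))"
  have q: "0 < q" "q < 1" using x by (auto simp: q_def field_simps)
  let ?f = "\<lambda>k a. chain_sum (\<le>) a k * x ^ a" and ?s = "fact (Suc k) / pochhammer (1 - x) (Suc k)"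
  have rec: "?f (Suc k) (Suc a) = ?f k (Suc a) + q * ?f (Suc k) a" for a
  proof -
    have "{m. Suc m \<le> Suc (Suc k)} = insert (Suc k) {m. Suc m \<le> Suc k}" by auto
    thus ?thesis by (simp add: weak.chain_sum_Suc[of a "Suc k"] weak.chain_sum_Suc[of a k] q_def algebra_simps)
  qed
  \<comment> \<open>Unrolling \<open>rec\<close> in \<open>a\<close> exhibits the Cauchy product
    with that geometric series.\<close>
  have conv: "?f (Suc k) a = (\<Sum>i\<le>a. ?f k i * q ^ (a - i))" for a
  proof (induction a)
    case (Suc a)
    have "(\<Sum>i\<le>Suc a. ?f k i * q ^ (Suc a - i)) = ?f k (Suc a) + (\<Sum>i\<le>a. q * (?f k i * q ^ (a - i)))"
      by (auto simp: Suc_diff_le mult_ac intro!: sum.cong)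
    thus ?case by (simp only: rec Suc.IH sum_distrib_left)
  qed (simp add: weak.chain_sum_0)
  have "(\<lambda>a. \<Sum>i\<le>a. ?f k i * q ^ (a - i)) sums ((\<Sum>a. ?f k a) * (\<Sum>a. q ^ a))"
    using Suc x q weak.chain_sum_nonneg
    by (intro Cauchy_product_sums) (auto simp: abs_mult power_abs sums_iff)
  hence "?f (Suc k) sums (?s * (1 / (1 - q)))"
    unfolding conv using Suc geometric_sums[of q] q by (simp add: sums_iff)
  also have "1 - q = (1 - x + real (Suc k)) / real (Suc (Suc k))" by (simp add: q_def field_simps)
  also have "?s * (1 / \<dots>) = fact (Suc (Suc k)) / pochhammer (1 - x) (Suc (Suc k))"
    by (simp add: pochhammer_Suc[of _ "Suc k"])
  finally show ?case .
qed

subsection \<open>Generating functions\<close>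

lemma sum_pairs_eq: "(\<Sum>(a, b)\<in>{(a, b). a + b = n}. f a b) = (\<Sum>a\<le>n. f a (n - a))" for n :: nat
  by (rule sum.reindex_bij_witness[where i = "\<lambda>a. (a, n - a)" and j = fst]) auto

text \<open>One term of a nonnegative series is at most its sum. At \<open>x = 1/2\<close> this
  bounds each nested sum by a closed form, from which summability over \<open>k\<close>
  follows.\<close>

lemma chain_sum_le:
  assumes "0 < x" "(\<lambda>a. chain_sum R a k * x ^ a) sums s" "index_order R"
  shows "chain_sum R a k \<le> s / x ^ a"
proof -
  interpret index_order R by fact
  have "(\<Sum>i\<in>{a}. chain_sum R i k * x ^ i) \<le> (\<Sum>i. chain_sum R i k * x ^ i)"
    using assms chain_sum_nonneg by (intro sum_le_suminf) (auto simp: sums_iff)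
  also have "\<dots> = s" using assms(2) by (simp add: sums_iff)
  finally have "chain_sum R a k * x ^ a \<le> s" by simp
  thus ?thesis using assms by (simp add: field_simps)
qed

lemma summable_chain_sum_strict:
  assumes "2 \<le> b"
  shows "summable (\<lambda>k. chain_sum (<) a k / real (Suc k) ^ b)"
proof (rule summable_comparison_test'[where N = 0])
  let ?p = "\<lambda>k. pochhammer (1 + 1 / 2 :: real) k / fact k"
  show "summable (\<lambda>k. 2 ^ Suc a * (?p k / ((real k + 1) * (real k + 1 + 1 / 2))))"
    by (intro summable_mult summable_rising_ratio) auto
  fix k
  have p: "0 \<le> ?p k" by (simp add: pochhammer_nonneg)
  have "chain_sum (<) a k \<le> 2 ^ a * ?p k"
    using chain_sum_le[OF _ sums_chain_sum_strict[of k "1/2"], of a] strict.index_order_axioms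
    by (simp add: power_divide mult_ac)
  moreover have "real (Suc k) ^ 2 \<le> real (Suc k) ^ b" using assms by (intro power_increasing) auto
  ultimately have "chain_sum (<) a k / real (Suc k) ^ b \<le> 2 ^ a * ?p k / real (Suc k) ^ 2"
    using mult_nonneg_nonneg[OF _ p, of "2 ^ a"] by (intro frac_le) auto
  also have "\<dots> \<le> 2 ^ a * ?p k / ((real k + 1) * (real k + 1 + 1 / 2) / 2)"
    using mult_nonneg_nonneg[OF _ p, of "2 ^ a"]
    by (intro divide_left_mono mult_pos_pos zero_less_power divide_pos_pos)
       (auto simp: power2_eq_square algebra_simps)
  finally show "norm (chain_sum (<) a k / real (Suc k) ^ b) \<le>
      2 ^ Suc a * (?p k / ((real k + 1) * (real k + 1 + 1 / 2)))"
    using strict.chain_sum_nonneg[of a k] by (simp add: mult_ac)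
qed

lemma summable_chain_sum_weak:
  assumes "2 \<le> b"
  shows "summable (\<lambda>k. chain_sum (\<le>) a k / real (Suc k) ^ b)"
proof (rule summable_comparison_test'[where N = 0])
  let ?y = "1 / 2 :: real"
  show "summable (\<lambda>k. 2 ^ a * (beta_nat ?y k / (real k + ?y)))"
    by (intro summable_mult summable_beta_nat) auto
  fix k
  have "chain_sum (\<le>) a k \<le> 2 ^ a * (fact (Suc k) / pochhammer ?y (Suc k))"
    using chain_sum_le[OF _ sums_chain_sum_weak[of "1/2" k], of a] weak.index_order_axioms
    by (simp add: power_divide mult_ac)
  also have "fact (Suc k) / pochhammer ?y (Suc k) = beta_nat ?y k * real (Suc k)"
    by (simp add: beta_nat_def mult_ac)
  finally have le: "chain_sum (\<le>) a k \<le> 2 ^ a * (beta_nat ?y k * real (Suc k))" .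
  moreover have "real (Suc k) ^ 2 \<le> real (Suc k) ^ b" using assms by (intro power_increasing) auto
  ultimately have "chain_sum (\<le>) a k / real (Suc k) ^ b \<le>
      2 ^ a * (beta_nat ?y k * real (Suc k)) / real (Suc k) ^ 2"
    using beta_nat_pos[of ?y k] by (intro frac_le) (auto simp: less_imp_le)
  also have "\<dots> = 2 ^ a * beta_nat ?y k / real (Suc k)"
    by (simp add: power2_eq_square)
  also have "\<dots> \<le> 2 ^ a * beta_nat ?y k / (real k + ?y)"
    using beta_nat_pos[of ?y k] by (intro divide_left_mono) (auto simp: less_imp_le)
  finally show "norm (chain_sum (\<le>) a k / real (Suc k) ^ b) \<le> 2 ^ a * (beta_nat ?y k / (real k + ?y))"
    using weak.chain_sum_nonneg[of a k] by simp
qed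

lemma mzv_eq_suminf:
  "2 \<le> b \<Longrightarrow> mzv (replicate a 1 @ [b]) = (\<Sum>k. chain_sum (<) a k / real (Suc k) ^ b)"
  unfolding mzv_def by (intro strict.infsum_mzv_term summable_chain_sum_strict)

lemma mzv_star_eq_suminf:
  "2 \<le> b \<Longrightarrow> mzv_star (replicate a 1 @ [b]) = (\<Sum>k. chain_sum (\<le>) a k / real (Suc k) ^ b)"
  unfolding mzv_star_def by (intro weak.infsum_mzv_term summable_chain_sum_weak)

text \<open>The parameter \<open>e = \<plusminus>1\<close> covers the signed and the unsigned sum at once.\<close>

lemma sums_chain_sum_convolution:
  assumes R: "index_order R" and x: "0 < x" "x < 1" and e: "\<bar>e\<bar> = (1::real)"
    and s: "(\<lambda>a. chain_sum R a k * x ^ a) sums s"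
  shows "(\<lambda>n. (\<Sum>a\<le>n. e ^ (n - a) * (chain_sum R a k / real (Suc k) ^ (n - a + 2))) * x ^ n) sums
    (s / ((real k + 1) * (real k + 1 - e * x)))"
proof -
  interpret index_order R by fact
  define q where "q = e * x / real (Suc k)"
  have "\<bar>q\<bar> < 1" using x e by (simp add: q_def abs_mult)
  hence q: "norm q < 1" by simp
  have ex: "e * x < 1" using x e by (auto simp: abs_if split: if_splits)
  let ?f = "\<lambda>a. chain_sum R a k * x ^ a"
  have sm: "summable (\<lambda>a. norm (?f a))"
    using s x chain_sum_nonneg by (simp add: sums_iff abs_mult)
  \<comment> \<open>The sum over the last exponent is the geometric series in
    \<open>q\<close>.\<close>
  have "(\<lambda>n. \<Sum>a\<le>n. ?f a * q ^ (n - a)) sums (suminf ?f * suminf (\<lambda>n. q ^ n))"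
    using q sm by (intro Cauchy_product_sums) (auto simp: power_abs)
  hence "(\<lambda>n. \<Sum>a\<le>n. ?f a * q ^ (n - a)) sums (s * (1 / (1 - q)))"
    using s geometric_sums[OF q] by (simp add: sums_iff)
  hence "(\<lambda>n. (\<Sum>a\<le>n. ?f a * q ^ (n - a)) / (real (Suc k))\<^sup>2) sums (s * (1 / (1 - q)) / (real (Suc k))\<^sup>2)"
    by (rule sums_divide)
  also have "(\<lambda>n. (\<Sum>a\<le>n. ?f a * q ^ (n - a)) / (real (Suc k))\<^sup>2) =
    (\<lambda>n. (\<Sum>a\<le>n. e ^ (n - a) * (chain_sum R a k / real (Suc k) ^ (n - a + 2))) * x ^ n)"
  proof
    fix n
    have "?f a * q ^ (n - a) / (real (Suc k))\<^sup>2 =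
        e ^ (n - a) * (chain_sum R a k / real (Suc k) ^ (n - a + 2)) * x ^ n" if "a \<le> n" for a
    proof -
      have "x ^ n = x ^ a * x ^ (n - a)" using that by (simp add: power_add[symmetric])
      thus ?thesis by (simp only: q_def power_mult_distrib power_divide power_add) (simp add: mult_ac)
    qed
    thus "(\<Sum>a\<le>n. ?f a * q ^ (n - a)) / (real (Suc k))\<^sup>2 =
       (\<Sum>a\<le>n. e ^ (n - a) * (chain_sum R a k / real (Suc k) ^ (n - a + 2))) * x ^ n"
      unfolding sum_divide_distrib sum_distrib_right by (intro sum.cong) auto
  qed
  also have "s * (1 / (1 - q)) / (real (Suc k))\<^sup>2 = s / ((real k + 1) * (real k + 1 - e * x))"
  proof -
    have "1 - q = (real k + 1 - e * x) / real (Suc k)" by (simp add: q_def field_simps)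
    thus ?thesis using ex by (simp add: power2_eq_square add_ac)
  qed
  finally show ?thesis .
qed

lemma sums_Z_minus:
  assumes x: "0 < x" "x < 1"
  shows "(\<lambda>n. Z_minus n * x ^ n) sums ((pi * x / sin (pi * x) - 1) / x\<^sup>2)"
proof -
  define c where
    "c e k n = (\<Sum>a\<le>n. e ^ (n - a) * (chain_sum (<) a k / real (Suc k) ^ (n - a + 2)))"
    for e :: real and k n
  let ?p = "\<lambda>k. pochhammer (1 + x) k / fact k"
  have c: "(\<lambda>n. c e k n * x ^ n) sums (?p k / ((real k + 1) * (real k + 1 - e * x)))"
    if "\<bar>e\<bar> = 1" for e k
    unfolding c_def
    by (rule sums_chain_sum_convolution[OF strict.index_order_axioms x that sums_chain_sum_strict])
  have "(\<lambda>n. (\<Sum>k. c (-1) k n) * x ^ n) sums (\<Sum>k. ?p k / ((real k + 1) * (real k + 1 - (-1) * x)))"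
  proof (rule sums_powser_of_series[OF x(1)])
    show "\<bar>c (-1) k n\<bar> \<le> c 1 k n" for k n
      unfolding c_def
      by (rule order_trans[OF sum_abs]) (simp add: abs_mult power_abs strict.chain_sum_nonneg)
    show "(\<lambda>n. c (-1) k n * x ^ n) sums (?p k / ((real k + 1) * (real k + 1 - (-1) * x)))"
      "(\<lambda>n. c 1 k n * x ^ n) sums (?p k / ((real k + 1) * (real k + 1 - 1 * x)))" for k
      by (intro c; simp)+
    show "summable (\<lambda>k. ?p k / ((real k + 1) * (real k + 1 - 1 * x)))"
    proof (rule summable_comparison_test'[where N = 0])
      \<comment> \<open>The unsigned majorant has \<open>k + 1 - x\<close> in place of
        \<open>k + 1 + x\<close>; the ratio of the two is extreme at \<open>k = 0\<close>, which
        gives the constant.\<close>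
      show "summable (\<lambda>k. (1 + x) / (1 - x) * (?p k / ((real k + 1) * (real k + 1 + x))))"
        by (intro summable_mult summable_rising_ratio x)
      fix k
      have p0: "0 \<le> pochhammer (1 + x) k" using x by (simp add: pochhammer_nonneg)
      hence p: "0 \<le> ?p k" by simp
      have "(1 - x) * (real k + 1 + x) \<le> (1 + x) * (real k + 1 - x)"
        using x by (simp add: algebra_simps)
      hence "(1 - x) / (1 + x) * (real k + 1 + x) \<le> real k + 1 - x"
        using x by (simp add: field_simps)
      hence "(real k + 1) * ((1 - x) / (1 + x) * (real k + 1 + x)) \<le> (real k + 1) * (real k + 1 - x)"
        by (intro mult_left_mono) auto
      hence "?p k / ((real k + 1) * (real k + 1 - x)) \<le>
          ?p k / ((real k + 1) * ((1 - x) / (1 + x) * (real k + 1 + x)))"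
        using p x by (intro divide_left_mono mult_pos_pos) auto
      thus "norm (?p k / ((real k + 1) * (real k + 1 - 1 * x))) \<le>
          (1 + x) / (1 - x) * (?p k / ((real k + 1) * (real k + 1 + x)))"
        using p0 x by (simp add: mult_ac)
    qed
  qed
  also have "(\<Sum>k. ?p k / ((real k + 1) * (real k + 1 - (-1) * x))) = (pi * x / sin (pi * x) - 1) / x\<^sup>2"
    using sums_rising_ratio[OF x] by (simp add: sums_iff)
  also have "(\<lambda>n. \<Sum>k. c (-1) k n) = Z_minus"
  proof
    fix n
    have "(\<Sum>k. c (-1) k n) = (\<Sum>a\<le>n. \<Sum>k. (-1) ^ (n - a) * (chain_sum (<) a k / real (Suc k) ^ (n - a + 2)))"
      unfolding c_def by (intro suminf_sum summable_mult summable_chain_sum_strict) simp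
    also have "\<dots> = (\<Sum>a\<le>n. (-1) ^ (n - a) * mzv (replicate a 1 @ [n - a + 2]))"
      by (intro sum.cong refl, subst mzv_eq_suminf, simp, intro suminf_mult summable_chain_sum_strict) simp
    finally show "(\<Sum>k. c (-1) k n) = Z_minus n" unfolding Z_minus_def sum_pairs_eq .
  qed
  finally show ?thesis .
qed

text \<open>The coefficients \<open>csc_coeff 0\<close> and \<open>csc_coeff 1\<close> vanish, so
  division by \<open>x^2\<close> shifts the cosecant series by two places.\<close>

lemma Z_minus_eq: "Z_minus n = csc_coeff (n + 2)"
proof -
  have "(\<lambda>n. csc_coeff (n + 2) * x ^ n) sums ((pi * x / sin (pi * x) - 1) / x\<^sup>2)"
    if x: "0 < x" "x < 1" for x
  proof -
    have "(\<Sum>i<2. csc_coeff i * x ^ i) = 0"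
      by (simp add: numeral_2_eq_2 csc_coeff_def cot_coeff_def)
    hence "(\<lambda>n. csc_coeff (n + 2) * x ^ (n + 2)) sums (pi * x / sin (pi * x) - 1)"
      using sums_csc_coeff[OF x] by (subst sums_iff_shift) simp
    hence "(\<lambda>n. csc_coeff (n + 2) * x ^ (n + 2) / x\<^sup>2) sums ((pi * x / sin (pi * x) - 1) / x\<^sup>2)"
      by (rule sums_divide)
    thus ?thesis using x by (simp only: power_add) simp
  qed
  with sums_Z_minus have "Z_minus = (\<lambda>n. csc_coeff (n + 2))" by (rule powser_unique_right)
  thus ?thesis by (rule fun_cong)
qed

text \<open>The closed form of the weak chains is \<open>(k + 1) * beta_nat (1 - x) k\<close>, and
  the factor \<open>k + 1\<close> cancels. All coefficients are nonnegative, so they are their own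
  majorant.\<close>

lemma sums_Z_star_plus:
  assumes x: "0 < x" "x < 1"
  shows "(\<lambda>n. Z_star_plus n * x ^ n) sums (\<Sum>k. beta_nat (1 - x) k / (real k + (1 - x)))"
proof -
  define c where
    "c k n = (\<Sum>a\<le>n. 1 ^ (n - a) * (chain_sum (\<le>) a k / real (Suc k) ^ (n - a + 2)))" for k n
  have c: "(\<lambda>n. c k n * x ^ n) sums (beta_nat (1 - x) k / (real k + (1 - x)))" for k
  proof -
    have "(\<lambda>n. c k n * x ^ n) sums
        (fact (Suc k) / pochhammer (1 - x) (Suc k) / ((real k + 1) * (real k + 1 - 1 * x)))"
      unfolding c_def
      by (rule sums_chain_sum_convolution[OF weak.index_order_axioms x _ sums_chain_sum_weak[OF x]]) simp
    also have "fact (Suc k) / pochhammer (1 - x) (Suc k) / ((real k + 1) * (real k + 1 - 1 * x)) =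
        beta_nat (1 - x) k / (real k + (1 - x))"
    proof -
      have "fact (Suc k) / pochhammer (1 - x) (Suc k) = beta_nat (1 - x) k * (real k + 1)"
        by (simp add: beta_nat_def mult_ac add_ac)
      moreover have "real k + 1 - 1 * x = real k + (1 - x)" by simp
      moreover have "real k + 1 \<noteq> 0" by linarith
      ultimately show ?thesis by simp
    qed
    finally show ?thesis .
  qed
  have "(\<lambda>n. (\<Sum>k. c k n) * x ^ n) sums (\<Sum>k. beta_nat (1 - x) k / (real k + (1 - x)))"
  proof (rule sums_powser_of_series[OF x(1) c _ c])
    show "\<bar>c k n\<bar> \<le> c k n" for k n
      unfolding c_def by (simp add: sum_nonneg weak.chain_sum_nonneg)
    show "summable (\<lambda>k. beta_nat (1 - x) k / (real k + (1 - x)))"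
      using x by (intro summable_beta_nat) simp
  qed
  also have "(\<lambda>n. \<Sum>k. c k n) = Z_star_plus"
  proof
    fix n
    have "(\<Sum>k. c k n) = (\<Sum>a\<le>n. \<Sum>k. 1 ^ (n - a) * (chain_sum (\<le>) a k / real (Suc k) ^ (n - a + 2)))"
      unfolding c_def by (intro suminf_sum summable_mult summable_chain_sum_weak) simp
    also have "\<dots> = (\<Sum>a\<le>n. mzv_star (replicate a 1 @ [n - a + 2]))"
      by (intro sum.cong refl, subst mzv_star_eq_suminf) simp_all
    finally show "(\<Sum>k. c k n) = Z_star_plus n" unfolding Z_star_plus_def sum_pairs_eq .
  qed
  finally show ?thesis .
qed

text \<open>Subtracting the terms with even base twice turns the zeta series into the alternating
  one; as the base is \<open>Suc i\<close>, these are the terms with \<open>i\<close> odd.\<close>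

lemma sums_eta:
  assumes n: "2 \<le> n"
  shows "(\<lambda>i. (-1) ^ i / real (Suc i) ^ n) sums ((1 - 2 / 2 ^ n) * zeta_nat n)"
proof -
  define h :: "nat \<Rightarrow> real" where "h i = (if odd i then 2 / real (Suc i) ^ n else 0)" for i
  have z: "(\<lambda>k. 1 / real (Suc k) ^ n) sums zeta_nat n"
    by (rule summable_sums[OF summable_zeta_nat[OF n]])
  have "(\<lambda>k. 2 / 2 ^ n * (1 / real (Suc k) ^ n)) sums (2 / 2 ^ n * zeta_nat n)"
    by (rule sums_mult[OF z])
  also have "(\<lambda>k. 2 / 2 ^ n * (1 / real (Suc k) ^ n)) = (\<lambda>k. h (2 * k + 1))"
  proof
    fix k
    have "real (Suc (2 * k + 1)) = 2 * real (Suc k)" by simp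
    thus "2 / 2 ^ n * (1 / real (Suc k) ^ n) = h (2 * k + 1)"
      by (simp only: h_def power_mult_distrib) simp
  qed
  finally have "(\<lambda>k. h (2 * k + 1)) sums (2 / 2 ^ n * zeta_nat n)" .
  moreover have "even i" if "i \<notin> range (\<lambda>k. 2 * k + 1)" for i :: nat
    using that by (metis oddE rangeI)
  ultimately have "h sums (2 / 2 ^ n * zeta_nat n)"
    by (subst (asm) sums_mono_reindex) (auto simp: strict_mono_def h_def)
  from sums_diff[OF z this]
  have "(\<lambda>i. 1 / real (Suc i) ^ n - h i) sums ((1 - 2 / 2 ^ n) * zeta_nat n)"
    by (simp add: algebra_simps)
  also have "(\<lambda>i. 1 / real (Suc i) ^ n - h i) = (\<lambda>i. (-1) ^ i / real (Suc i) ^ n)"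
    by (auto simp: h_def diff_divide_distrib[symmetric])
  finally show ?thesis .
qed

text \<open>Expanding each \<open>2 / (i + 1 - x)^2\<close> by the differentiated geometric series
  gives the factor \<open>Suc n\<close>; the coefficient that remains is an alternating zeta
  series.\<close>

lemma Z_star_plus_eq:
  "Z_star_plus n = 2 * real (Suc n) * ((1 - 2 / 2 ^ (n + 2)) * zeta_nat (n + 2))"
proof -
  define c :: "nat \<Rightarrow> nat \<Rightarrow> real"
    where "c i n = 2 * real (Suc n) * ((-1) ^ i / real (Suc i) ^ (n + 2))" for i n
  have "(\<lambda>n. (\<Sum>i. c i n) * x ^ n) sums (\<Sum>k. beta_nat (1 - x) k / (real k + (1 - x)))"
    if x: "0 < x" "x < 1" for x
  proof -
    have geo: "(\<lambda>n. 2 * real (Suc n) * (1 / real (Suc i) ^ (n + 2)) * x ^ n) sums (2 / (real i + (1 - x))\<^sup>2)"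
      for i
    proof -
      define q where "q = x / real (Suc i)"
      have q: "norm q < 1" using x by (simp add: q_def)
      have "(\<lambda>n. 2 / (real (Suc i))\<^sup>2 * (real (Suc n) * q ^ n)) sums (2 / (real (Suc i))\<^sup>2 * (1 / (1 - q)\<^sup>2))"
        using geometric_deriv_sums[OF q] by (intro sums_mult) simp
      also have "(\<lambda>n. 2 / (real (Suc i))\<^sup>2 * (real (Suc n) * q ^ n)) =
          (\<lambda>n. 2 * real (Suc n) * (1 / real (Suc i) ^ (n + 2)) * x ^ n)"
        by (simp add: q_def power_divide power_add power2_eq_square mult_ac del: of_nat_Suc)
      also have "2 / (real (Suc i))\<^sup>2 * (1 / (1 - q)\<^sup>2) = 2 / (real (Suc i) * (1 - q))\<^sup>2"
        by (simp add: power_mult_distrib)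
      also have "real (Suc i) * (1 - q) = real i + (1 - x)"
        by (simp add: q_def field_simps)
      finally show ?thesis .
    qed
    have "(\<lambda>n. (\<Sum>i. c i n) * x ^ n) sums (\<Sum>i. 2 * (-1) ^ i / (real i + (1 - x))\<^sup>2)"
    proof (rule sums_powser_of_series[OF x(1) _ _ geo])
      show "(\<lambda>n. c i n * x ^ n) sums (2 * (-1) ^ i / (real i + (1 - x))\<^sup>2)" for i
        using sums_mult[OF geo[of i], of "(-1) ^ i"] by (simp add: c_def mult_ac)
      show "\<bar>c i n\<bar> \<le> 2 * real (Suc n) * (1 / real (Suc i) ^ (n + 2))" for i n
        by (simp add: c_def abs_mult)
      show "summable (\<lambda>i. 2 / (real i + (1 - x))\<^sup>2)"
      proof (rule summable_comparison_test'[where N = 0])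
        show "summable (\<lambda>i. 2 / (1 - x)\<^sup>2 * (1 / real (Suc i) ^ 2))"
          by (intro summable_mult summable_zeta_nat) simp
        fix i
        have "(1 - x) * real (Suc i) \<le> real i + (1 - x)" using x by (simp add: algebra_simps)
        hence "((1 - x) * real (Suc i))\<^sup>2 \<le> (real i + (1 - x))\<^sup>2" using x by (intro power_mono) auto
        hence "2 / (real i + (1 - x))\<^sup>2 \<le> 2 / ((1 - x) * real (Suc i))\<^sup>2"
          using x by (intro divide_left_mono mult_pos_pos zero_less_power) auto
        thus "norm (2 / (real i + (1 - x))\<^sup>2) \<le> 2 / (1 - x)\<^sup>2 * (1 / real (Suc i) ^ 2)"
          by (simp add: power_mult_distrib)
      qed
    qed
    thus ?thesis using sums_alternating_beta_nat[of "1 - x"] x by (simp add: sums_iff)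
  qed
  with sums_Z_star_plus have "Z_star_plus = (\<lambda>n. \<Sum>i. c i n)" by (rule powser_unique_right)
  moreover have "(\<Sum>i. c i n) = 2 * real (Suc n) * ((1 - 2 / 2 ^ (n + 2)) * zeta_nat (n + 2))"
    unfolding c_def by (rule sums_unique[symmetric], rule sums_mult, rule sums_eta) simp
  ultimately show ?thesis by metis
qed

subsection \<open>The convolution\<close>

text \<open>For even \<open>n\<close> the eta value in \<open>Z_star_plus n\<close> is half of
  \<open>csc_coeff (n + 2)\<close>; at odd indices \<open>csc_coeff\<close> is 0.\<close>

lemma Z_star_plus_even_eq:
  assumes "even n"
  shows "Z_star_plus n = real (Suc n) * csc_coeff (n + 2)"
  unfolding Z_star_plus_eq csc_coeff_def cot_coeff_def using assms by simp

lemma riemann_zeta_of_nat: "riemann_zeta (real n) = zeta_nat n"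
  unfolding riemann_zeta_def by (simp add: powr_realpow del: of_nat_Suc)

theorem theorem1p2:
  fixes p :: nat
  shows "(\<Sum>m=0..p. Z_minus (2 * m) * Z_star_plus (2 * p - 2 * m)) =
    (2 * real p + 2) * (2 * real p + 1 + 1 / 2 ^ (2 * p + 2)) * riemann_zeta (2 * real p + 4)"
proof -
  define u where "u m = csc_coeff (2 * m + 2)" for m
  let ?n = "2 * p + 4"
  define L where "L = (\<Sum>m=0..p. Z_minus (2 * m) * Z_star_plus (2 * p - 2 * m))"
  have L1: "L = (\<Sum>m\<le>p. (2 * real (p - m) + 1) * (u m * u (p - m)))"
    unfolding L_def atLeast0AtMost
  proof (intro sum.cong refl)
    fix m
    have "2 * p - 2 * m = 2 * (p - m)" by simp
    thus "Z_minus (2 * m) * Z_star_plus (2 * p - 2 * m) = (2 * real (p - m) + 1) * (u m * u (p - m))"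
      by (simp only: Z_minus_eq Z_star_plus_even_eq[of "2 * (p - m)", simplified] u_def) simp
  qed
  also have "\<dots> = (\<Sum>m\<le>p. (2 * real m + 1) * (u m * u (p - m)))"
    by (rule sum.reindex_bij_witness[where i = "\<lambda>m. p - m" and j = "\<lambda>m. p - m"]) auto
  finally have L2: "L = (\<Sum>m\<le>p. (2 * real m + 1) * (u m * u (p - m)))" .
  \<comment> \<open>Averaging the sum with its reflection under \<open>m\<close> to
    \<open>p - m\<close> makes the weight constant:
    \<open>(2 * (p - m) + 1) + (2 * m + 1) = 2 * p + 2\<close>.\<close>
  have "L + L = (\<Sum>m\<le>p. (2 * real p + 2) * (u m * u (p - m)))"
    by (subst (1) L1, subst L2, subst sum.distrib[symmetric])
       (auto simp: of_nat_diff algebra_simps intro!: sum.cong)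
  hence L: "2 * L = (2 * real p + 2) * (\<Sum>m\<le>p. u m * u (p - m))"
    by (simp add: sum_distrib_left)
  have "(\<Sum>m\<le>p. u m * u (p - m)) = (\<Sum>i\<in>(\<lambda>m. 2 * m + 2) ` {..p}. csc_coeff i * csc_coeff (?n - i))"
    by (subst sum.reindex) (auto simp: inj_on_def u_def algebra_simps intro!: sum.cong arg_cong[where f = csc_coeff])
  also have "\<dots> = (\<Sum>i\<le>?n. csc_coeff i * csc_coeff (?n - i))"
  proof (rule sum.mono_neutral_left)
    show "\<forall>i\<in>{..?n} - (\<lambda>m. 2 * m + 2) ` {..p}. csc_coeff i * csc_coeff (?n - i) = 0"
    proof
      fix i assume i: "i \<in> {..?n} - (\<lambda>m. 2 * m + 2) ` {..p}"
      \<comment> \<open>Outside the image one factor is a vanishing coefficient, so the sum over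
        \<open>m\<close> is the full convolution at \<open>2 * p + 4\<close>.\<close>
      have "odd i \<or> i < 2 \<or> ?n - i < 2"
      proof (rule ccontr)
        assume "\<not> ?thesis"
        hence "i = 2 * (i div 2 - 1) + 2" "i div 2 - 1 \<le> p" by (auto elim!: evenE)
        thus False using i by blast
      qed
      thus "csc_coeff i * csc_coeff (?n - i) = 0"
        by (auto simp: csc_coeff_def cot_coeff_def)
    qed
  qed auto
  also have "\<dots> = (real ?n - 1) * cot_coeff ?n - 2 * csc_coeff ?n"
    by (rule csc_coeff_convolution)
  \<comment> \<open>With \<open>n = 2 * p + 4\<close> the factor is
    \<open>(n - 1) - 2 * (1 - 2 / 2 ^ n) = n - 3 + 4 / 2 ^ n\<close>.\<close>
  also have "\<dots> = 2 * ((2 * real p + 1 + 1 / 2 ^ (2 * p + 2)) * zeta_nat ?n)"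
    unfolding csc_coeff_def cot_coeff_def by (simp add: power_add field_simps del: of_nat_Suc)
  also have "zeta_nat ?n = riemann_zeta (2 * real p + 4)"
    using riemann_zeta_of_nat[of ?n] by simp
  finally show ?thesis using L unfolding L_def by simp
qed

end
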